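(* Let $m_1,\dots,m_n$ be nonnegative integers, $|M|=m_1+\dots+m_n$, and let $k$ be a nonnegative integer with $|M|-2k\ge0$. For generic $z^0\in Z$, the $sl_2$ Gaudin hamiltonians $$\mathcal{H}_i(z^0)=\sum_{j\ne i}\frac{\Omega_{ij}}{z^0_i-z^0_j},\qquad i=1,\dots,n,$$ acting on $\mathrm{Sing}_k(L^{\otimes M})$ have a simple spectrum, i.e. $\mathrm{Sing}_k(L^{\otimes M})$ has a basis of common eigenvectors of $\mathcal{H}_1(z^0),\dots,\mathcal{H}_n(z^0)$ for which the $n$-tuples of eigenvalues of different basis vectors are different.
   Context: $Z=\{z\in\mathbb{C}^n : z_j\ne z_q \text{ for } j\neq q\}$; "generic $z^0$" means outside a suitable proper algebraic subset of $\mathbb{C}^n$. $e,f,h$ are the standard generators of $sl_2(\mathbb{C})$: $[e,f]=h$, $[h,e]=2e$, $[h,f]=-2f$. $L_m$ is the irreducible $sl_2$-module of highest weight $m$, $L^{\otimes M}=L_{m_1}\otimes\dots\otimes L_{m_n}$. $\Omega=e\otimes f+f\otimes e+\frac12h\otimes h$, and $\Omega_{ij}:L^{\otimes M}\to L^{\otimes M}$ acts as $\Omega$ on the $i$-th and $j$-th factors and as the identity on all others. $\mathrm{Sing}_k(L^{\otimes M})=\{w\in L^{\otimes M} : ew=0,\ hw=(|M|-2k)w\}$, which is invariant under the (mutually commuting) operators $\mathcal{H}_i(z^0)$. *)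

theory Defs
  imports "HOL-Analysis.Analysis" "HOL-Library.Function_Algebras"
begin

definition cscale :: "complex \<Rightarrow> ('a \<Rightarrow> complex) \<Rightarrow> 'a \<Rightarrow> complex" where
  "cscale c v = (\<lambda>x. c * v x)"

global_interpretation cfun: vector_space "cscale :: complex \<Rightarrow> ('a \<Rightarrow> complex) \<Rightarrow> 'a \<Rightarrow> complex"
  by unfold_locales (auto simp: cscale_def fun_eq_iff algebra_simps)

text \<open>
  The usual model with basis \<open>v\<^sub>0, \<dots>, v\<^sub>m\<close>, where \<open>v\<^sub>0\<close> is the highest weight vector and
  \<open>f v\<^sub>r = v\<^bsub>r+1\<^esub>\<close> (with \<open>v\<^bsub>m+1\<^esub> = 0\<close>), \<open>e v\<^sub>r = r (m - r + 1) v\<^bsub>r-1\<^esub>\<close>, \<open>h v\<^sub>r = (m - 2 r) v\<^sub>r\<close>.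
  A vector is given by its coordinate function, so that \<open>v r\<close> is the coefficient of \<open>v\<^sub>r\<close>.
\<close>

definition sl2_L :: "nat \<Rightarrow> (nat \<Rightarrow> complex) set" where
  "sl2_L m = {v. \<forall>r>m. v r = 0}"

definition sl2_e :: "nat \<Rightarrow> (nat \<Rightarrow> complex) \<Rightarrow> nat \<Rightarrow> complex" where
  "sl2_e m v = (\<lambda>r. of_nat (r + 1) * (of_nat m - of_nat r) * v (r + 1))"

definition sl2_f :: "nat \<Rightarrow> (nat \<Rightarrow> complex) \<Rightarrow> nat \<Rightarrow> complex" where
  "sl2_f m v = (\<lambda>r. if 1 \<le> r \<and> r \<le> m then v (r - 1) else 0)"

definition sl2_h :: "nat \<Rightarrow> (nat \<Rightarrow> complex) \<Rightarrow> nat \<Rightarrow> complex" where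
  "sl2_h m v = (\<lambda>r. (of_nat m - 2 * of_nat r) * v r)"

lemma subspace_sl2_L: "cfun.subspace (sl2_L m)"
  by (auto simp: cfun.subspace_def sl2_L_def cscale_def)

lemma sl2_L_closed:
  assumes "v \<in> sl2_L m"
  shows "sl2_e m v \<in> sl2_L m" "sl2_f m v \<in> sl2_L m" "sl2_h m v \<in> sl2_L m"
  using assms by (auto simp: sl2_L_def sl2_e_def sl2_f_def sl2_h_def)

lemma sl2_L_relations:
  assumes "v \<in> sl2_L m"
  shows "sl2_e m (sl2_f m v) - sl2_f m (sl2_e m v) = sl2_h m v"
    and "sl2_h m (sl2_e m v) - sl2_e m (sl2_h m v) = cscale 2 (sl2_e m v)"
    and "sl2_h m (sl2_f m v) - sl2_f m (sl2_h m v) = cscale (-2) (sl2_f m v)"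
proof -
  show "sl2_e m (sl2_f m v) - sl2_f m (sl2_e m v) = sl2_h m v"
  proof
    fix r
    show "(sl2_e m (sl2_f m v) - sl2_f m (sl2_e m v)) r = sl2_h m v r"
    proof (cases "r > m")
      case True
      then show ?thesis using assms by (simp add: sl2_L_def sl2_e_def sl2_f_def sl2_h_def)
    next
      case False
      then show ?thesis
        by (cases r; cases "r = m") (auto simp: sl2_e_def sl2_f_def sl2_h_def algebra_simps)
    qed
  qed
  show "sl2_h m (sl2_e m v) - sl2_e m (sl2_h m v) = cscale 2 (sl2_e m v)"
    by (auto simp: fun_eq_iff sl2_e_def sl2_h_def cscale_def algebra_simps)
  show "sl2_h m (sl2_f m v) - sl2_f m (sl2_h m v) = cscale (-2) (sl2_f m v)"
  proof
    fix r
    show "(sl2_h m (sl2_f m v) - sl2_f m (sl2_h m v)) r = cscale (-2) (sl2_f m v) r"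
      by (cases r) (auto simp: sl2_f_def sl2_h_def cscale_def algebra_simps)
  qed
qed

lemma sl2_L_highest_weight:
  defines "v0 \<equiv> (\<lambda>r. if r = 0 then 1 else 0)"
  shows "v0 \<in> sl2_L m" "v0 \<noteq> 0" "sl2_e m v0 = 0" "sl2_h m v0 = cscale (of_nat m) v0"
  by (auto simp: v0_def sl2_L_def sl2_e_def sl2_h_def cscale_def fun_eq_iff)

lemma sl2_L_irreducible:
  assumes W: "cfun.subspace W" "W \<subseteq> sl2_L m" "W \<noteq> {0}"
    and e: "\<And>v. v \<in> W \<Longrightarrow> sl2_e m v \<in> W"
    and f: "\<And>v. v \<in> W \<Longrightarrow> sl2_f m v \<in> W"
  shows "W = sl2_L m"
proof -
  define u :: "nat \<Rightarrow> nat \<Rightarrow> complex" where "u = (\<lambda>s r. if r = s then 1 else 0)"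
  have u0: "u 0 \<in> W" if "w \<in> W" "w s \<noteq> 0" "\<forall>r>s. w r = 0" for w s
    using that
  proof (induction s arbitrary: w)
    case 0
    have "u 0 = cscale (1 / w 0) w"
      using 0 by (auto simp: u_def cscale_def fun_eq_iff)
    then show ?case using 0 W(1) by (simp add: cfun.subspace_scale)
  next
    case (Suc s)
    have "Suc s \<le> m"
      using Suc.prems W(2) by (metis (mono_tags, lifting) mem_Collect_eq not_le sl2_L_def subset_iff)
    then have "(of_nat m :: complex) \<noteq> of_nat s" by simp
    moreover have "(1 + of_nat s :: complex) \<noteq> 0"
      by (metis of_nat_Suc of_nat_neq_0)
    ultimately have "sl2_e m w s \<noteq> 0" "\<forall>r>s. sl2_e m w r = 0"
      using Suc.prems by (auto simp: sl2_e_def)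
    then show ?case using Suc.IH e Suc.prems(1) by blast
  qed
  obtain w where w: "w \<in> W" "w \<noteq> 0"
    using W cfun.subspace_0 by blast
  then obtain q where q: "w q \<noteq> 0" by (auto simp: fun_eq_iff)
  have fin: "finite {r. w r \<noteq> 0}"
    by (rule finite_subset[of _ "{..m}"]) (use w W(2) in \<open>force simp: sl2_L_def not_less[symmetric]\<close>, simp)
  have "w (Max {r. w r \<noteq> 0}) \<noteq> 0"
    using Max_in[OF fin] q by auto
  moreover have "\<forall>r>Max {r. w r \<noteq> 0}. w r = 0"
    using Max_ge[OF fin] by (metis (mono_tags, lifting) mem_Collect_eq not_le)
  ultimately have "u 0 \<in> W" using u0 w(1) by blast
  then have us: "u s \<in> W" if "s \<le> m" for s
    using that
  proof (induction s)
    case (Suc s)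
    have "sl2_f m (u s) = u (Suc s)"
      using Suc.prems by (auto simp: u_def sl2_f_def fun_eq_iff)
    then show ?case using f Suc by (metis Suc_leD)
  qed
  have "v \<in> W" if "v \<in> sl2_L m" for v
  proof -
    have "v r = (\<Sum>s\<le>m. cscale (v s) (u s)) r" for r
    proof -
      have ap: "(\<Sum>s\<in>A. cscale (v s) (u s)) r = (\<Sum>s\<in>A. cscale (v s) (u s) r)" for A
        by (induction A rule: infinite_finite_induct) auto
      show ?thesis
        using that unfolding ap
        by (auto simp: cscale_def u_def sl2_L_def not_le[symmetric] if_distrib cong: if_cong)
    qed
    then have "v = (\<Sum>s\<le>m. cscale (v s) (u s))" by blast
    also have "\<dots> \<in> W"
      using W(1) us by (intro cfun.subspace_sum cfun.subspace_scale) auto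
    finally show ?thesis .
  qed
  then show ?thesis using W(2) by blast
qed

text \<open>
  The factors are numbered \<open>1, \<dots>, n\<close>, and \<open>m i\<close> is the highest weight of the \<open>i\<close>-th one.
  A tensor is given by its coordinates with respect to the product basis
  \<open>v\<^bsub>a 1\<^esub> \<otimes> \<dots> \<otimes> v\<^bsub>a n\<^esub>\<close>.
\<close>

type_synonym tensor = "(nat \<Rightarrow> nat) \<Rightarrow> complex"

definition tensor_index :: "nat \<Rightarrow> (nat \<Rightarrow> nat) \<Rightarrow> (nat \<Rightarrow> nat) set" where
  "tensor_index n m = (\<Pi>\<^sub>E i\<in>{1..n}. {0..m i})"

definition tensor_space :: "nat \<Rightarrow> (nat \<Rightarrow> nat) \<Rightarrow> tensor set" where
  "tensor_space n m = {w. \<forall>a. a \<notin> tensor_index n m \<longrightarrow> w a = 0}"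

definition pure_tensor :: "nat \<Rightarrow> (nat \<Rightarrow> nat) \<Rightarrow> (nat \<Rightarrow> nat \<Rightarrow> complex) \<Rightarrow> tensor" where
  "pure_tensor n m v = (\<lambda>a. if a \<in> tensor_index n m then \<Prod>i\<in>{1..n}. v i (a i) else 0)"

text \<open>
  \<open>on_factor i X\<close> is \<open>1 \<otimes> \<dots> \<otimes> X \<otimes> \<dots> \<otimes> 1\<close> with \<open>X\<close> in the \<open>i\<close>-th place: \<open>X\<close> is applied to
  the coordinates of the tensor as a function of the \<open>i\<close>-th index, the other ones being fixed.
\<close>

definition on_factor :: "nat \<Rightarrow> ((nat \<Rightarrow> complex) \<Rightarrow> nat \<Rightarrow> complex) \<Rightarrow> tensor \<Rightarrow> tensor" where
  "on_factor i X w = (\<lambda>a. X (\<lambda>r. w (a(i := r))) (a i))"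

lemma on_factor_pure_tensor:
  assumes i: "i \<in> {1..n}" and v: "v i \<in> sl2_L (m i)"
    and X: "\<And>c u. X (cscale c u) = cscale c (X u)" "\<And>u. u \<in> sl2_L (m i) \<Longrightarrow> X u \<in> sl2_L (m i)"
  shows "on_factor i X (pure_tensor n m v) = pure_tensor n m (v(i := X (v i)))"
proof
  fix a
  define P where "P = (\<Prod>j\<in>{1..n} - {i}. v j (a j))"
  define good where "good \<longleftrightarrow> (\<forall>j. if j \<in> {1..n} then j \<noteq> i \<longrightarrow> a j \<le> m j else a j = undefined)"
  have idx: "a(i := r) \<in> tensor_index n m \<longleftrightarrow> good \<and> r \<le> m i" for r
    using i by (auto simp: good_def tensor_index_def PiE_iff extensional_def split: if_splits)
  have idx': "a \<in> tensor_index n m \<longleftrightarrow> good \<and> a i \<le> m i"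
    using idx[of "a i"] by simp
  have prod: "(\<Prod>j\<in>{1..n}. v j ((a(i := r)) j)) = v i r * P" for r
    using i by (subst prod.remove[of _ i]) (auto simp: P_def intro!: arg_cong2[of _ _ _ _ "(*)"] prod.cong)
  have slice: "(\<lambda>r. pure_tensor n m v (a(i := r))) = cscale (if good then P else 0) (v i)"
    using v by (auto simp: fun_eq_iff pure_tensor_def idx prod cscale_def sl2_L_def simp del: fun_upd_apply One_nat_def)
  have prod': "(\<Prod>j\<in>{1..n}. (v(i := X (v i))) j (a j)) = X (v i) (a i) * P"
    using i by (subst prod.remove[of _ i]) (auto simp: P_def intro!: arg_cong2[of _ _ _ _ "(*)"] prod.cong)
  show "on_factor i X (pure_tensor n m v) a = pure_tensor n m (v(i := X (v i))) a"
    unfolding on_factor_def slice X(1) using X(2)[OF v]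
    by (auto simp: cscale_def pure_tensor_def idx' prod' sl2_L_def simp del: fun_upd_apply One_nat_def)
qed

definition tensor_e :: "nat \<Rightarrow> (nat \<Rightarrow> nat) \<Rightarrow> tensor \<Rightarrow> tensor" where
  "tensor_e n m w = (\<Sum>i\<in>{1..n}. on_factor i (sl2_e (m i)) w)"

definition tensor_h :: "nat \<Rightarrow> (nat \<Rightarrow> nat) \<Rightarrow> tensor \<Rightarrow> tensor" where
  "tensor_h n m w = (\<Sum>i\<in>{1..n}. on_factor i (sl2_h (m i)) w)"

definition Sing :: "nat \<Rightarrow> (nat \<Rightarrow> nat) \<Rightarrow> nat \<Rightarrow> tensor set" where
  "Sing n m k = {w \<in> tensor_space n m. tensor_e n m w = 0 \<and>
     tensor_h n m w = cscale (of_nat (\<Sum>i\<in>{1..n}. m i) - 2 * of_nat k) w}"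

text \<open>Only meaningful for \<open>i \<noteq> j\<close>, both in \<open>{1..n}\<close>.\<close>

definition Omega :: "(nat \<Rightarrow> nat) \<Rightarrow> nat \<Rightarrow> nat \<Rightarrow> tensor \<Rightarrow> tensor" where
  "Omega m i j w =
     on_factor i (sl2_e (m i)) (on_factor j (sl2_f (m j)) w)
   + on_factor i (sl2_f (m i)) (on_factor j (sl2_e (m j)) w)
   + cscale (1 / 2) (on_factor i (sl2_h (m i)) (on_factor j (sl2_h (m j)) w))"

definition gaudin :: "nat \<Rightarrow> (nat \<Rightarrow> nat) \<Rightarrow> (nat \<Rightarrow> complex) \<Rightarrow> nat \<Rightarrow> tensor \<Rightarrow> tensor" where
  "gaudin n m z i w = (\<Sum>j\<in>{1..n} - {i}. cscale (1 / (z i - z j)) (Omega m i j w))"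

definition simple_spectrum ::
    "'i set \<Rightarrow> ('i \<Rightarrow> ('a \<Rightarrow> complex) \<Rightarrow> 'a \<Rightarrow> complex) \<Rightarrow> ('a \<Rightarrow> complex) set \<Rightarrow> bool" where
  "simple_spectrum I H V \<longleftrightarrow>
     (\<exists>B ev. cfun.independent B \<and> cfun.span B = V \<and>
        (\<forall>b\<in>B. \<forall>i\<in>I. H i b = cscale (ev b i) b) \<and>
        (\<forall>b\<in>B. \<forall>b'\<in>B. b \<noteq> b' \<longrightarrow> (\<exists>i\<in>I. ev b i \<noteq> ev b' i)))"

definition affine_space :: "nat \<Rightarrow> (nat \<Rightarrow> complex) set" where
  "affine_space n = (\<Pi>\<^sub>E i\<in>{1..n}. UNIV)"

inductive polynomial_fun :: "nat \<Rightarrow> ((nat \<Rightarrow> complex) \<Rightarrow> complex) \<Rightarrow> bool" for n where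
  const: "polynomial_fun n (\<lambda>z. c)"
| coord: "i \<in> {1..n} \<Longrightarrow> polynomial_fun n (\<lambda>z. z i)"
| add: "polynomial_fun n p \<Longrightarrow> polynomial_fun n q \<Longrightarrow> polynomial_fun n (\<lambda>z. p z + q z)"
| mult: "polynomial_fun n p \<Longrightarrow> polynomial_fun n q \<Longrightarrow> polynomial_fun n (\<lambda>z. p z * q z)"

definition algebraic_subset :: "nat \<Rightarrow> (nat \<Rightarrow> complex) set \<Rightarrow> bool" where
  "algebraic_subset n A \<longleftrightarrow>
     (\<exists>P. (\<forall>p\<in>P. polynomial_fun n p) \<and> A = {z \<in> affine_space n. \<forall>p\<in>P. p z = 0})"

definition proper_algebraic_subset :: "nat \<Rightarrow> (nat \<Rightarrow> complex) set \<Rightarrow> bool" where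
  "proper_algebraic_subset n A \<longleftrightarrow> algebraic_subset n A \<and> A \<noteq> affine_space n"

definition config_space :: "nat \<Rightarrow> (nat \<Rightarrow> complex) set" where
  "config_space n =
     {z \<in> affine_space n. \<forall>j\<in>{1..n}. \<forall>q\<in>{1..n}. j \<noteq> q \<longrightarrow> z j \<noteq> z q}"

end

theory Submission
  imports Defs "Subresultants.Subresultant_Gcd" "Jordan_Normal_Form.Char_Poly"
    "HOL-Computational_Algebra.Field_as_Ring"
begin

text \<open>
  The Hamiltonians commute (\<open>gaudin_op_commute\<close>, from the classical Yang--Baxter identity for
  \<open>\<Omega>\<close>), so it is enough to find one linear combination \<open>K(z) = \<Sum>\<^sub>i c\<^sub>i D(z) H\<^sub>i(z)\<close>, with fixed
  constants \<open>c\<^sub>i\<close> and \<open>D(z) = \<Prod>\<^bsub>i \<noteq> j\<^esub> (z\<^sub>i - z\<^sub>j)\<close>, which has as many eigenvalues on the space of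
  singular vectors as its dimension: each eigenline is then an eigenline of every \<open>H\<^sub>i(z)\<close>, and the
  eigenvalues of the \<open>H\<^sub>i(z)\<close> determine that of \<open>K(z)\<close> (\<open>simple_spectrum_of_card\<close>).
  That \<open>K(z)\<close> has distinct eigenvalues means that the discriminant of its characteristic polynomial
  does not vanish (\<open>discr_endo_mat_nonzero_iff\<close>). As the factor \<open>D(z)\<close> clears the denominators,
  this discriminant is a polynomial in \<open>z\<close>, and its zero set is the exceptional algebraic set.
  What remains is to choose the \<open>c\<^sub>i\<close> such that the discriminant is nonzero at one point.

  This point is taken with \<open>\<bar>z\<^sub>1\<bar> << \<bar>z\<^sub>2\<bar> << \<dots> << \<bar>z\<^sub>n\<bar>\<close>: for \<open>z\<^sub>i = \<epsilon>\<^sup>-\<^sup>i\<close> and \<open>\<epsilon> \<rightarrow> 0\<close>, the operators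
  \<open>z\<^sub>i H\<^sub>i(z)\<close> converge to \<open>G\<^sub>i = \<Sum>\<^bsub>j < i\<^esub> \<Omega>\<^sub>i\<^sub>j\<close>, and the discriminant is continuous in \<open>\<epsilon>\<close>. So it
  suffices that a combination of \<open>G\<^sub>1, \<dots>, G\<^sub>n\<close> has distinct eigenvalues (\<open>simple_limit\<close>), which is
  proved by induction on the number of tensor factors. Filter the singular vectors in
  \<open>L\<^bsub>m 1\<^esub> \<otimes> \<dots> \<otimes> L\<^bsub>m (p+1)\<^esub>\<close> by the highest \<open>s\<close> such that \<open>v\<^sub>s\<close> occurs in the last factor. The
  coefficient of \<open>v\<^sub>s\<close> is a singular vector in the first \<open>p\<close> factors, so the \<open>s\<close>-th graded piece
  embeds into a space of such vectors, on which \<open>G\<^sub>1, \<dots>, G\<^sub>p\<close> act as before while \<open>G\<^bsub>p+1\<^esub>\<close> acts by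
  a number (\<open>slice_limit_op\<close>). These numbers differ for different nonzero pieces, because there are
  no singular vectors of negative weight (\<open>top_value_inj\<close>, \<open>sing_negative_weight\<close>). To pass
  from the graded pieces to the whole space, ``simple spectrum'' is expressed by conditions that are
  inherited by subspaces and by extensions with disjoint spectra (\<open>simple_on_extend\<close>).
\<close>

section \<open>The ring of endomorphisms\<close>

typedef 'a endo = "{T :: ('a \<Rightarrow> complex) \<Rightarrow> 'a \<Rightarrow> complex. Vector_Spaces.linear cscale cscale T}"
  morphisms act Abs_endo
  by (rule exI[of _ "\<lambda>_. 0"]) (auto simp: Vector_Spaces.linear_iff cfun.vector_space_axioms)

setup_lifting type_definition_endo

lemma sum_fun_apply: "(\<Sum>i\<in>A. f i) x = (\<Sum>i\<in>A. f i x)"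
  for f :: "'i \<Rightarrow> 'a \<Rightarrow> complex"
  by (induction A rule: infinite_finite_induct) auto

lemma linear_cscale_iff:
  "Vector_Spaces.linear cscale cscale T \<longleftrightarrow>
     (\<forall>v w. T (v + w) = T v + T w) \<and> (\<forall>c v. T (cscale c v) = cscale c (T v))"
  by (simp add: Vector_Spaces.linear_iff cfun.vector_space_axioms)

instantiation endo :: (type) ring_1
begin
lift_definition zero_endo :: "'a endo" is "\<lambda>_. 0"
  by (simp add: linear_cscale_iff)
lift_definition one_endo :: "'a endo" is "\<lambda>v. v"
  by (simp add: linear_cscale_iff)
lift_definition plus_endo :: "'a endo \<Rightarrow> 'a endo \<Rightarrow> 'a endo" is "\<lambda>S T v. S v + T v"
  by (simp add: linear_cscale_iff cfun.scale_right_distrib)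
lift_definition minus_endo :: "'a endo \<Rightarrow> 'a endo \<Rightarrow> 'a endo" is "\<lambda>S T v. S v - T v"
  by (simp add: linear_cscale_iff cfun.scale_right_diff_distrib)
lift_definition uminus_endo :: "'a endo \<Rightarrow> 'a endo" is "\<lambda>S v. - S v"
  by (simp add: linear_cscale_iff)
lift_definition times_endo :: "'a endo \<Rightarrow> 'a endo \<Rightarrow> 'a endo" is "\<lambda>S T v. S (T v)"
  by (simp add: linear_cscale_iff)
instance
proof
  show "(0::'a endo) \<noteq> 1"
    by transfer (auto simp: fun_eq_iff intro!: exI[of _ "\<lambda>_. 1"])
qed (transfer; auto simp: fun_eq_iff linear_cscale_iff)+
end

lift_definition scal :: "complex \<Rightarrow> 'a endo" is cscale
  by (simp add: linear_cscale_iff cfun.scale_right_distrib mult.commute)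

lemma act_simps [simp]:
  "act 0 v = 0" "act 1 v = v" "act (S + T) v = act S v + act T v"
  "act (S - T) v = act S v - act T v" "act (- S) v = - act S v"
  "act (S * T) v = act S (act T v)" "act (scal c) v = cscale c v"
  by (transfer; simp)+

lemma act_sum [simp]: "act (\<Sum>i\<in>A. T i) v = (\<Sum>i\<in>A. act (T i) v)"
  by (induction A rule: infinite_finite_induct) auto

lemma act_linear [simp]:
  "act T (v + w) = act T v + act T w" "act T (cscale c v) = cscale c (act T v)"
  "act T (v - w) = act T v - act T w" "act T 0 = 0" "act T (- v) = - act T v"
proof -
  show *: "act T (v + w) = act T v + act T w" "act T (cscale c v) = cscale c (act T v)" for v w c
    by (transfer; simp add: linear_cscale_iff)+
  show "act T 0 = 0" using *(2)[of 0 0] by simp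
  show "act T (- v) = - act T v" for v
    using *(2)[of "-1" v] by simp
  have "act T (v - w) + act T w = act T v" by (simp flip: *(1))
  then show "act T (v - w) = act T v - act T w" by (simp add: algebra_simps)
qed

lemma act_sum_right: "act T (\<Sum>i\<in>A. v i) = (\<Sum>i\<in>A. act T (v i))"
  by (induction A rule: infinite_finite_induct)
     (simp_all only: sum.insert sum.infinite sum.empty act_linear not_False_eq_True)

lemma endo_eqI: "(\<And>v. act S v = act T v) \<Longrightarrow> S = T"
  by transfer auto

lemma scal_central: "scal c * T = T * scal c"
  by (rule endo_eqI) simp

lemma scal_mult [simp]: "scal a * scal b = scal (a * b)"
  by (rule endo_eqI) simp

lemma scal_add: "scal a + scal b = scal (a + b)"
  by (rule endo_eqI) (simp add: cfun.scale_left_distrib)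

lemma scal_diff: "scal a - scal b = scal (a - b)"
  by (rule endo_eqI) (simp add: cfun.scale_left_diff_distrib)

lemma scal_0: "scal 0 = 0"
  by (rule endo_eqI) simp

section \<open>Commutativity of the Gaudin Hamiltonians\<close>

definition commutator :: "'r::ring_1 \<Rightarrow> 'r \<Rightarrow> 'r" where
  "commutator A B = A * B - B * A"

lemma commutator_add: "commutator (A + B) C = commutator A C + commutator B C" "commutator C (A + B) = commutator C A + commutator C B"
  by (auto simp: commutator_def algebra_simps)

lemma commutator_mult: "commutator (A * B) C = A * commutator B C + commutator A C * B" "commutator C (A * B) = A * commutator C B + commutator C A * B"
  by (auto simp: commutator_def algebra_simps)

lemma commutator_self: "commutator A A = 0" by (simp add: commutator_def)

lemma commutator_swap: "commutator A B = - commutator B A" by (simp add: commutator_def)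

lemma commutator_sum: "commutator (\<Sum>i\<in>I. T i) C = (\<Sum>i\<in>I. commutator (T i) C)" "commutator C (\<Sum>i\<in>I. T i) = (\<Sum>i\<in>I. commutator C (T i))"
  by (auto simp: commutator_def sum_distrib_left sum_distrib_right sum_subtractf)

lemma commutator_scal: "commutator (scal c) T = 0" "commutator T (scal c) = 0"
  by (simp_all add: commutator_def scal_central)

lemma commutator_scal_mult: "commutator (scal a * S) (scal b * T) = scal (a * b) * commutator S T"
  "commutator (scal a * S) T = scal a * commutator S T" "commutator T (scal a * S) = scal a * commutator T S"
  by (simp_all add: commutator_def right_diff_distrib) (metis mult.assoc scal_central scal_mult)+

text \<open>
  Up to truncation these are the actions of \<open>e, f, h\<close> on the \<open>i\<close>-th tensor factor. Outside the range
  \<open>a i \<le> m i\<close> of the indices they are cut off to \<open>0\<close>, so that the \<open>sl\<^sub>2\<close> relations hold as identities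
  in the ring of endomorphisms, not only on the tensor space.
\<close>

lift_definition opE :: "(nat \<Rightarrow> nat) \<Rightarrow> nat \<Rightarrow> (nat \<Rightarrow> nat) endo" is
  "\<lambda>m i w a. if a i < m i then of_nat (a i + 1) * (of_nat (m i) - of_nat (a i)) * w (a(i := a i + 1)) else 0"
  by (auto simp: linear_cscale_iff fun_eq_iff cscale_def algebra_simps)

lift_definition opF :: "(nat \<Rightarrow> nat) \<Rightarrow> nat \<Rightarrow> (nat \<Rightarrow> nat) endo" is
  "\<lambda>m i w a. if 1 \<le> a i \<and> a i \<le> m i then w (a(i := a i - 1)) else 0"
  by (auto simp: linear_cscale_iff fun_eq_iff cscale_def algebra_simps)

lift_definition opH :: "(nat \<Rightarrow> nat) \<Rightarrow> nat \<Rightarrow> (nat \<Rightarrow> nat) endo" is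
  "\<lambda>m i w a. if a i \<le> m i then (of_nat (m i) - 2 * of_nat (a i)) * w a else 0"
  by (auto simp: linear_cscale_iff fun_eq_iff cscale_def algebra_simps)

lemmas op_apply = opE.rep_eq opF.rep_eq opH.rep_eq

lemma commutator_same_factor:
  "commutator (opE m i) (opF m i) = opH m i"
  "commutator (opH m i) (opE m i) = scal 2 * opE m i"
  "commutator (opH m i) (opF m i) = scal (-2) * opF m i"
proof -
  show "commutator (opE m i) (opF m i) = opH m i"
  proof (rule endo_eqI, rule ext)
    fix v a
    show "act (commutator (opE m i) (opF m i)) v a = act (opH m i) v a"
      by (cases "a i") (auto simp: commutator_def op_apply algebra_simps fun_upd_idem)
  qed
  show "commutator (opH m i) (opE m i) = scal 2 * opE m i"
    by (rule endo_eqI, rule ext) (auto simp: commutator_def op_apply cscale_def algebra_simps)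
  show "commutator (opH m i) (opF m i) = scal (-2) * opF m i"
  proof (rule endo_eqI, rule ext)
    fix v a
    show "act (commutator (opH m i) (opF m i)) v a = act (scal (-2) * opF m i) v a"
      by (cases "a i") (auto simp: commutator_def op_apply cscale_def algebra_simps fun_upd_idem)
  qed
qed

lemma commutator_other_factor:
  assumes "i \<noteq> j" "X \<in> {opE, opF, opH}" "Y \<in> {opE, opF, opH}"
  shows "commutator (X m i) (Y m j) = 0"
  using assms
  by (auto intro!: endo_eqI ext simp: commutator_def op_apply fun_upd_twist)

definition Om :: "(nat \<Rightarrow> nat) \<Rightarrow> nat \<Rightarrow> nat \<Rightarrow> (nat \<Rightarrow> nat) endo" where
  "Om m i j = opE m i * opF m j + opF m i * opE m j + scal (1/2) * (opH m i * opH m j)"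

lemma Om_sym:
  assumes "i \<noteq> j" shows "Om m i j = Om m j i"
proof -
  have "X m i * Y m j = Y m j * X m i" if "X \<in> {opE, opF, opH}" "Y \<in> {opE, opF, opH}" for X Y
    using commutator_other_factor[OF assms that, of m] by (simp add: commutator_def)
  then show ?thesis by (simp add: Om_def add.commute)
qed

lemma commutator_same_factor':
  "commutator (opF m i) (opE m i) = - opH m i"
  "commutator (opE m i) (opH m i) = - (scal 2 * opE m i)"
  "commutator (opF m i) (opH m i) = scal 2 * opF m i"
proof -
  have "- (scal (-2) * opF m i) = scal 2 * opF m i"
    by (rule endo_eqI) (simp del: act_linear(2))
  then show "commutator (opF m i) (opE m i) = - opH m i" "commutator (opE m i) (opH m i) = - (scal 2 * opE m i)"
    "commutator (opF m i) (opH m i) = scal 2 * opF m i"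
    using commutator_same_factor[of m i] commutator_swap[of "opF m i" "opE m i"] commutator_swap[of "opE m i" "opH m i"]
      commutator_swap[of "opF m i" "opH m i"] by simp_all
qed

text \<open>
  \<open>\<Omega>\<close> commutes with the diagonal action of \<open>sl\<^sub>2\<close> on two factors. Both the classical Yang--Baxter
  identity and the invariance of the singular vectors follow from this.
\<close>

lemma commutator_Om_pair:
  assumes "i \<noteq> j" "X \<in> {opE, opF, opH}"
  shows "commutator (Om m i j) (X m i + X m j) = 0"
proof -
  have z: "commutator (Y m i) (Z m j) = 0" "commutator (Y m j) (Z m i) = 0"
    if "Y \<in> {opE, opF, opH}" "Z \<in> {opE, opF, opH}" for Y Z
    using commutator_other_factor that assms(1) by metis+
  show ?thesis
    using assms(2)
    by (auto simp: Om_def commutator_add commutator_mult commutator_scal commutator_self z commutator_same_factor commutator_same_factor')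
       (auto intro!: endo_eqI simp: cfun.scale_right_distrib cfun.scale_right_diff_distrib)
qed

lemma commutator_Om_other:
  assumes "i \<noteq> k" "j \<noteq> k" "X \<in> {opE, opF, opH}"
  shows "commutator (Om m i j) (X m k) = 0" 
  using assms(3) commutator_other_factor[OF assms(1)] commutator_other_factor[OF assms(2)]
  by (auto simp: Om_def commutator_add commutator_mult commutator_scal)

lemma commutator_Om_total:
  assumes "i \<noteq> j" "finite I" "i \<in> I" "j \<in> I" "X \<in> {opE, opF, opH}"
  shows "commutator (Om m i j) (\<Sum>k\<in>I. X m k) = 0"
proof -
  have "(\<Sum>k\<in>I. X m k) = (X m i + X m j) + (\<Sum>k\<in>I - {i, j}. X m k)"
  proof -
    have "I = insert i (insert j (I - {i, j}))" using assms by auto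
    then have "(\<Sum>k\<in>I. X m k) = (\<Sum>k\<in>insert i (insert j (I - {i, j})). X m k)" by simp
    also have "\<dots> = X m i + (X m j + (\<Sum>k\<in>I - {i, j}. X m k))"
      using assms by (subst sum.insert, simp, simp, subst sum.insert) simp_all
    finally show ?thesis by (simp add: add.assoc)
  qed
  moreover have "commutator (Om m i j) (\<Sum>k\<in>I - {i, j}. X m k) = 0"
    unfolding commutator_sum(2) using assms(5) by (intro sum.neutral) (auto intro!: commutator_Om_other)
  ultimately show ?thesis
    using commutator_Om_pair[OF assms(1,5), of m] by (simp add: commutator_add(2))
qed

text \<open>
  \<open>\<Omega>\<^sub>i\<^sub>k + \<Omega>\<^sub>j\<^sub>k\<close> is a combination of products of a diagonal operator \<open>X\<^sub>i + X\<^sub>j\<close> with an operator on the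
  \<open>k\<close>-th factor, and \<open>\<Omega>\<^sub>i\<^sub>j\<close> commutes with both.
\<close>

lemma yang_baxter:
  assumes "distinct [i, j, k]"
  shows "commutator (Om m i j) (Om m i k + Om m j k) = 0"
proof -
  have "Om m i k + Om m j k = (opE m i + opE m j) * opF m k + (opF m i + opF m j) * opE m k
      + scal (1/2) * ((opH m i + opH m j) * opH m k)"
    by (simp add: Om_def algebra_simps)
  moreover have "commutator (Om m i j) (X m i + X m j) = 0" "commutator (Om m i j) (X m k) = 0"
    if "X \<in> {opE, opF, opH}" for X
    using commutator_Om_pair[of i j X m] commutator_Om_other[of i k j X m] assms that by auto
  ultimately show ?thesis
    by (simp add: commutator_add(2) commutator_mult(2) commutator_scal_mult commutator_scal)
qed

lemma commutator_Om_disjoint: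
  assumes "{i, j} \<inter> {k, l} = {}"
  shows "commutator (Om m i j) (Om m k l) = 0"
proof -
  have "commutator (Om m i j) (X m k) = 0" "commutator (Om m i j) (X m l) = 0" if "X \<in> {opE, opF, opH}" for X
    using commutator_Om_other that assms by auto
  then show ?thesis
    unfolding Om_def[of m k l] by (simp add: commutator_add(2) commutator_mult(2) commutator_scal)
qed

definition gaudin_op :: "nat \<Rightarrow> (nat \<Rightarrow> nat) \<Rightarrow> (nat \<Rightarrow> complex) \<Rightarrow> nat \<Rightarrow> (nat \<Rightarrow> nat) endo" where
  "gaudin_op n m z i = (\<Sum>j\<in>{1..n} - {i}. scal (1 / (z i - z j)) * Om m i j)"

text \<open>
  Applied to the differences \<open>z\<^sub>i - z\<^sub>j\<close>, \<open>z\<^sub>i - z\<^sub>a\<close>, \<open>z\<^sub>j - z\<^sub>a\<close> of coordinates, this makes the coefficients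
  of \<open>[H\<^sub>i(z), H\<^sub>j(z)]\<close> cancel.
\<close>

lemma partial_fractions:
  fixes u v w :: complex
  assumes "u \<noteq> 0" "v \<noteq> 0" "w \<noteq> 0" "v = u + w"
  shows "1 / u * (1 / w) - 1 / v * (1 / u) - 1 / v * (1 / w) = 0"
proof -
  have "1 / u * (1 / w) - 1 / v * (1 / u) - 1 / v * (1 / w) = (v - w - u) / (u * v * w)"
    using assms(1-3) by (simp add: diff_divide_distrib)
  then show ?thesis using assms(4) by simp
qed

text \<open>
  Brackets of \<open>\<Omega>\<close>'s on disjoint pairs vanish, so \<open>[H\<^sub>i(z), H\<^sub>j(z)]\<close> splits into contributions of the
  third index \<open>a\<close>. By the Yang--Baxter identity the three brackets belonging to \<open>a\<close> agree up to sign,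
  and their coefficients add up to \<open>0\<close> by partial fractions.
\<close>

lemma gaudin_op_commute:
  assumes z: "z \<in> config_space n" and ij: "i \<in> {1..n}" "j \<in> {1..n}"
  shows "gaudin_op n m z i * gaudin_op n m z j = gaudin_op n m z j * gaudin_op n m z i"
proof (cases "i = j")
  case False
  define s where "s a b = 1 / (z a - z b)" for a b
  define R where "R = {1..n} - {i, j}"
  have Ri: "{1..n} - {i} = insert j R" "{1..n} - {j} = insert i R" "finite R" "i \<notin> R" "j \<notin> R"
    using ij False by (auto simp: R_def)
  have red: "commutator (gaudin_op n m z i) (gaudin_op n m z j)
      = (\<Sum>a\<in>insert j R. \<Sum>b\<in>insert i R. scal (s i a * s j b) * commutator (Om m i a) (Om m j b))"
    unfolding gaudin_op_def Ri s_def
    by (subst commutator_sum(1), intro sum.cong refl, subst commutator_sum(2), intro sum.cong refl)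
       (rule commutator_scal_mult(1))
  have rest: "(\<Sum>b\<in>insert i R. scal (s i a * s j b) * commutator (Om m i a) (Om m j b))
     = scal (s i a * s j i) * commutator (Om m i a) (Om m j i) + scal (s i a * s j a) * commutator (Om m i a) (Om m j a)"
    if "a \<in> R" for a
  proof -
    have "(\<Sum>b\<in>R. scal (s i a * s j b) * commutator (Om m i a) (Om m j b))
        = (\<Sum>b\<in>R. if b = a then scal (s i a * s j a) * commutator (Om m i a) (Om m j a) else 0)"
    proof (intro sum.cong refl)
      fix b assume b: "b \<in> R"
      have "commutator (Om m i a) (Om m j b) = 0" if "b \<noteq> a"
        using that b \<open>a \<in> R\<close> Ri(4,5) False by (intro commutator_Om_disjoint) auto
      then show "scal (s i a * s j b) * commutator (Om m i a) (Om m j b)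
          = (if b = a then scal (s i a * s j a) * commutator (Om m i a) (Om m j a) else 0)" by simp
    qed
    then show ?thesis using Ri that by simp
  qed
  have first: "(\<Sum>b\<in>insert i R. scal (s i j * s j b) * commutator (Om m i j) (Om m j b))
     = (\<Sum>a\<in>R. scal (s i j * s j a) * commutator (Om m i j) (Om m j a))"
    using Ri False Om_sym[OF False, of m] by (simp add: commutator_self)
  have zero: "scal (s i j * s j a) * commutator (Om m i j) (Om m j a)
      + (scal (s i a * s j i) * commutator (Om m i a) (Om m j i) + scal (s i a * s j a) * commutator (Om m i a) (Om m j a)) = 0"
    if a: "a \<in> R" for a
  proof -
    define X where "X = commutator (Om m i j) (Om m j a)"
    have d: "distinct [i, j, a]" "distinct [j, a, i]" using a False by (auto simp: R_def)
    have "commutator (Om m i j) (Om m i a) = - X"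
      using yang_baxter[OF d(1), of m] by (simp add: X_def commutator_add(2) eq_neg_iff_add_eq_0)
    then have 1: "commutator (Om m i a) (Om m j i) = X"
      using commutator_swap[of "Om m i a" "Om m i j"] Om_sym[OF False, of m] by simp
    have "commutator (Om m j a) (Om m j i) + commutator (Om m j a) (Om m a i) = 0"
      using yang_baxter[OF d(2), of m] by (simp add: commutator_add(2))
    then have "commutator (Om m j a) (Om m i a) = X"
      using commutator_swap[of "Om m j a" "Om m i j"] Om_sym[OF False, of m] Om_sym[of a i m] d
      by (simp add: X_def)
    then have 2: "commutator (Om m i a) (Om m j a) = - X"
      using commutator_swap[of "Om m i a" "Om m j a"] by simp
    have ne: "z i \<noteq> z j" "z i \<noteq> z a" "z j \<noteq> z a"
      using z a ij False unfolding config_space_def R_def by auto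
    have "s i j * s j a + (s i a * s j i - s i a * s j a) = 0"
    proof -
      have n: "z i - z j \<noteq> 0" "z i - z a \<noteq> 0" "z j - z a \<noteq> 0" "z j - z i \<noteq> 0" using ne by auto
      have "s j i = - s i j"
        unfolding s_def by (subst minus_diff_eq[symmetric], subst divide_minus_right, rule refl)
      then have "s i j * s j a + (s i a * s j i - s i a * s j a) = s i j * s j a - s i a * s i j - s i a * s j a"
        by simp
      also have "\<dots> = 0" unfolding s_def by (rule partial_fractions) (use n in simp_all)
      finally show ?thesis .
    qed
    then have "scal (s i j * s j a) + (scal (s i a * s j i) - scal (s i a * s j a)) = (scal 0 :: (nat \<Rightarrow> nat) endo)"
      by (simp only: scal_add scal_diff)
    then have "(scal (s i j * s j a) + (scal (s i a * s j i) - scal (s i a * s j a))) * X = scal 0 * X"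
      by simp
    then show ?thesis unfolding 1 2 X_def[symmetric] scal_0
      by (simp only: distrib_right left_diff_distrib mult_minus_right add_uminus_conv_diff mult_zero_left)
  qed
  have "commutator (gaudin_op n m z i) (gaudin_op n m z j)
      = (\<Sum>b\<in>insert i R. scal (s i j * s j b) * commutator (Om m i j) (Om m j b))
        + (\<Sum>a\<in>R. \<Sum>b\<in>insert i R. scal (s i a * s j b) * commutator (Om m i a) (Om m j b))"
    unfolding red by (rule sum.insert[OF Ri(3,5)])
  also have "\<dots> = (\<Sum>a\<in>R. scal (s i j * s j a) * commutator (Om m i j) (Om m j a))
      + (\<Sum>a\<in>R. scal (s i a * s j i) * commutator (Om m i a) (Om m j i) + scal (s i a * s j a) * commutator (Om m i a) (Om m j a))"
    unfolding first by (intro arg_cong2[of _ _ _ _ "(+)"] refl sum.cong rest)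
  also have "\<dots> = 0"
    unfolding sum.distrib[symmetric] by (intro sum.neutral ballI zero)
  finally have "commutator (gaudin_op n m z i) (gaudin_op n m z j) = 0" .
  then show ?thesis by (simp add: commutator_def)
qed simp

section \<open>Operators with simple spectrum\<close>

definition shift_prod :: "'a endo \<Rightarrow> complex list \<Rightarrow> 'a endo" where
  "shift_prod K ls = (\<Prod>\<mu>\<leftarrow>ls. K - scal \<mu>)"

lemma shift_prod_simps [simp]:
  "shift_prod K [] = 1" "shift_prod K (\<mu> # ls) = (K - scal \<mu>) * shift_prod K ls"
  "shift_prod K (ls @ ls') = shift_prod K ls * shift_prod K ls'"
  by (simp_all add: shift_prod_def)

lemma shift_prod_eigenvector:
  assumes "act K v = cscale c v"
  shows "act (shift_prod K ls) v = cscale (\<Prod>\<mu>\<leftarrow>ls. c - \<mu>) v"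
proof (induction ls)
  case (Cons \<mu> ls)
  have "act (shift_prod K (\<mu> # ls)) v = cscale ((\<Prod>\<mu>\<leftarrow>ls. c - \<mu>) * c - \<mu> * (\<Prod>\<mu>\<leftarrow>ls. c - \<mu>)) v"
    unfolding shift_prod_simps act_simps Cons.IH
    by (simp add: assms cfun.scale_left_diff_distrib)
  also have "(\<Prod>\<mu>\<leftarrow>ls. c - \<mu>) * c - \<mu> * (\<Prod>\<mu>\<leftarrow>ls. c - \<mu>) = (\<Prod>\<mu>\<leftarrow>\<mu> # ls. c - \<mu>)"
    by (simp add: left_diff_distrib mult.commute)
  finally show ?case .
qed simp

lemma shift_prod_invariant:
  assumes "cfun.subspace V" "\<And>x. x \<in> V \<Longrightarrow> act K x \<in> V" "x \<in> V"
  shows "act (shift_prod K ls) x \<in> V"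
  using assms by (induction ls) (simp_all add: cfun.subspace_diff cfun.subspace_scale)

lemma prod_list_diff_nonzero:
  fixes c :: complex
  assumes "c \<notin> set ls" shows "(\<Prod>\<mu>\<leftarrow>ls. c - \<mu>) \<noteq> 0"
  using assms by (induction ls) auto

lemma cscale_eq_0_iff [simp]: "cscale c v = 0 \<longleftrightarrow> c = 0 \<or> v = 0"
  by (rule cfun.scale_eq_0_iff)

text \<open>
  A form of ``\<open>K\<close> has simple spectrum on \<open>V\<close>'': a polynomial with simple roots annihilates \<open>K\<close> on \<open>V\<close>,
  and eigenspaces are at most lines. Both conditions pass to subspaces of \<open>V\<close>.
\<close>

definition simple_on :: "'a endo \<Rightarrow> ('a \<Rightarrow> complex) set \<Rightarrow> complex list \<Rightarrow> bool" where
  "simple_on K V ls \<longleftrightarrow> distinct ls \<and> (\<forall>x\<in>V. act (shift_prod K ls) x = 0) \<and>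
     (\<forall>c. \<forall>v\<in>V. \<forall>w\<in>V. act K v = cscale c v \<longrightarrow> act K w = cscale c w \<longrightarrow> v \<noteq> 0 \<longrightarrow>
        (\<exists>a. w = cscale a v))"

lemma simple_on_eigenvalue:
  assumes "simple_on K V ls" "v \<in> V" "v \<noteq> 0" "act K v = cscale c v"
  shows "c \<in> set ls"
  using assms prod_list_diff_nonzero[of c ls] shift_prod_eigenvector[OF assms(4), of ls]
  by (auto simp: simple_on_def)

text \<open>
  The image of \<open>\<pi>\<close> may be a proper subspace of \<open>W\<close>, since \<open>simple_on\<close> passes to subspaces. A
  vector of \<open>V\<close> is moved into the kernel by the polynomial of
  \<open>K' + g\<close> and is then killed by that of the kernel; an eigenvector either lies in the kernel or is
  determined by its image.
\<close>

lemma simple_on_extend: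
  assumes V: "cfun.subspace V" and K: "\<And>x. x \<in> V \<Longrightarrow> act K x \<in> V"
    and W: "\<And>x. x \<in> V \<Longrightarrow> act \<pi> x \<in> W"
    and comm: "\<And>x. x \<in> V \<Longrightarrow> act \<pi> (act K x) = act K' (act \<pi> x) + cscale g (act \<pi> x)"
    and W_simple: "simple_on K' W ls'"
    and ker_simple: "simple_on K {x \<in> V. act \<pi> x = 0} ls"
    and disj: "\<And>\<mu>. \<mu> \<in> set ls' \<Longrightarrow> \<mu> + g \<notin> set ls"
  shows "simple_on K V (ls @ map (\<lambda>\<mu>. \<mu> + g) ls')"
  unfolding simple_on_def
proof (intro conjI ballI allI impI)
  show "distinct (ls @ map (\<lambda>\<mu>. \<mu> + g) ls')"
    using W_simple ker_simple disj by (auto simp: simple_on_def distinct_map inj_on_def)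
  have inter: "act \<pi> (act (shift_prod K (map (\<lambda>\<mu>. \<mu> + g) l)) x) = act (shift_prod K' l) (act \<pi> x)"
    if "x \<in> V" for l x
  proof (induction l)
    case (Cons \<mu> l)
    define y where "y = act (shift_prod K (map (\<lambda>\<mu>. \<mu> + g) l)) x"
    have y: "y \<in> V" unfolding y_def by (rule shift_prod_invariant[OF V K that])
    have "act \<pi> (act K y - cscale (\<mu> + g) y) = act K' (act \<pi> y) - cscale \<mu> (act \<pi> y)"
      by (simp add: comm[OF y] cfun.scale_left_distrib)
    then show ?case
      unfolding list.map shift_prod_simps act_simps y_def[symmetric] Cons.IH[folded y_def, symmetric] .
  qed simp
  show "act (shift_prod K (ls @ map (\<lambda>\<mu>. \<mu> + g) ls')) x = 0" if x: "x \<in> V" for x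
  proof -
    define y where "y = act (shift_prod K (map (\<lambda>\<mu>. \<mu> + g) ls')) x"
    have "y \<in> V" unfolding y_def by (rule shift_prod_invariant[OF V K x])
    moreover have "act \<pi> y = 0"
      using inter[OF x] W[OF x] W_simple by (simp add: y_def simple_on_def)
    ultimately have "act (shift_prod K ls) y = 0"
      using ker_simple by (simp add: simple_on_def)
    then show ?thesis by (simp add: y_def)
  qed
  show "\<exists>a. w = cscale a v"
    if v: "v \<in> V" "act K v = cscale c v" "v \<noteq> 0" and w: "w \<in> V" "act K w = cscale c w" for c v w
  proof -
    have ev: "act K' (act \<pi> u) = cscale (c - g) (act \<pi> u)" if "u \<in> V" "act K u = cscale c u" for u
      using comm[OF that(1)] that(2) by (simp add: cfun.scale_left_diff_distrib)
    show ?thesis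
    proof (cases "c \<in> set ls")
      case True
      then have "c - g \<notin> set ls'" using disj[of "c - g"] by auto
      then have "act \<pi> u = 0" if "u \<in> V" "act K u = cscale c u" for u
        using simple_on_eigenvalue[OF W_simple W _ ev] that by blast
      then show ?thesis using ker_simple v w unfolding simple_on_def by blast
    next
      case False
      have ker0: "u = 0" if "u \<in> V" "act \<pi> u = 0" "act K u = cscale c u" for u
        using simple_on_eigenvalue[OF ker_simple _ _ that(3)] that False by blast
      have "act \<pi> v \<noteq> 0" using ker0 v by blast
      then obtain a where a: "act \<pi> w = cscale a (act \<pi> v)"
        using W_simple W v w ev unfolding simple_on_def by meson
      have "w - cscale a v = 0"
        by (rule ker0) (use v w V a in \<open>simp_all add: cfun.subspace_diff cfun.subspace_scale
            cfun.scale_right_diff_distrib cfun.scale_left_commute\<close>)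
      then show ?thesis by auto
    qed
  qed
qed

text \<open>
  For the induction on the list of roots, decompose \<open>(K - \<mu>) x\<close> and divide the components by
  \<open>\<nu> - \<mu>\<close>. The sum of the results differs from \<open>x\<close> by an eigenvector for \<open>\<mu>\<close>.
\<close>

lemma eigenvector_decomposition:
  assumes "cfun.subspace V" "\<And>x. x \<in> V \<Longrightarrow> act K x \<in> V"
    and "x \<in> V" "distinct ls" "act (shift_prod K ls) x = 0"
  shows "\<exists>y. (\<forall>\<mu>\<in>set ls. y \<mu> \<in> V \<and> act K (y \<mu>) = cscale \<mu> (y \<mu>)) \<and> x = (\<Sum>\<mu>\<in>set ls. y \<mu>)"
  using assms(3-5)
proof (induction ls arbitrary: x rule: rev_induct)
  case (snoc \<mu> ls)
  define x' where "x' = act K x - cscale \<mu> x"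
  have "x' \<in> V" unfolding x'_def
    using snoc.prems(1) assms(1,2) by (simp add: cfun.subspace_diff cfun.subspace_scale)
  moreover have "act (shift_prod K ls) x' = 0"
    using snoc.prems(3) unfolding x'_def shift_prod_simps act_simps act_linear mult_1_right .
  ultimately obtain y where y: "\<And>\<nu>. \<nu> \<in> set ls \<Longrightarrow> y \<nu> \<in> V \<and> act K (y \<nu>) = cscale \<nu> (y \<nu>)"
      and x': "x' = (\<Sum>\<nu>\<in>set ls. y \<nu>)"
    using snoc.IH[of x'] snoc.prems(2) by auto
  have mu: "\<mu> \<notin> set ls" using snoc.prems(2) by simp
  define z where "z \<nu> = cscale (1 / (\<nu> - \<mu>)) (y \<nu>)" for \<nu>
  define x0 where "x0 = x - (\<Sum>\<nu>\<in>set ls. z \<nu>)"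
  have z: "z \<nu> \<in> V" "act K (z \<nu>) = cscale \<nu> (z \<nu>)" if "\<nu> \<in> set ls" for \<nu>
    using y[OF that] assms(1) by (simp_all add: z_def cfun.subspace_scale mult.commute)
  have "act K (z \<nu>) - cscale \<mu> (z \<nu>) = y \<nu>" if "\<nu> \<in> set ls" for \<nu>
  proof -
    have "\<nu> - \<mu> \<noteq> 0" using that mu by auto
    then show ?thesis using z(2)[OF that]
      by (simp add: z_def flip: cfun.scale_left_diff_distrib diff_divide_distrib)
  qed
  then have "(\<Sum>\<nu>\<in>set ls. act K (z \<nu>) - cscale \<mu> (z \<nu>)) = x'"
    unfolding x' by (rule sum.cong[OF refl])
  moreover have "act K x0 - cscale \<mu> x0 = x' - (\<Sum>\<nu>\<in>set ls. act K (z \<nu>) - cscale \<mu> (z \<nu>))"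
    by (simp add: x0_def x'_def act_sum_right cfun.scale_right_diff_distrib cfun.scale_sum_right
        sum_subtractf)
  ultimately have x0: "act K x0 = cscale \<mu> x0" by simp
  have x0V: "x0 \<in> V"
    unfolding x0_def by (intro cfun.subspace_diff cfun.subspace_sum assms(1) snoc.prems(1) z(1))
  show ?case
  proof (intro exI[of _ "z(\<mu> := x0)"] conjI ballI)
    fix \<nu> assume "\<nu> \<in> set (ls @ [\<mu>])"
    then show "(z(\<mu> := x0)) \<nu> \<in> V" "act K ((z(\<mu> := x0)) \<nu>) = cscale \<nu> ((z(\<mu> := x0)) \<nu>)"
      using z x0 x0V by auto
  next
    have "(\<Sum>\<nu>\<in>set ls. (z(\<mu> := x0)) \<nu>) = (\<Sum>\<nu>\<in>set ls. z \<nu>)"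
      using mu by (intro sum.cong) auto
    then show "x = (\<Sum>\<nu>\<in>set (ls @ [\<mu>]). (z(\<mu> := x0)) \<nu>)"
      using mu by (simp add: x0_def)
  qed
qed simp

lemma shift_prod_kill_others:
  assumes "finite \<Lambda>" "\<And>\<mu>. \<mu> \<in> \<Lambda> \<Longrightarrow> act K (u \<mu>) = cscale \<mu> (u \<mu>)" "\<nu> \<in> \<Lambda>" "set ls = \<Lambda> - {\<nu>}"
  shows "act (shift_prod K ls) (\<Sum>\<mu>\<in>\<Lambda>. cscale (c \<mu>) (u \<mu>))
    = cscale (\<Prod>\<mu>\<leftarrow>ls. \<nu> - \<mu>) (cscale (c \<nu>) (u \<nu>))"
proof -
  have "act (shift_prod K ls) (cscale (c \<mu>) (u \<mu>)) =
      (if \<mu> = \<nu> then cscale (\<Prod>\<mu>\<leftarrow>ls. \<nu> - \<mu>) (cscale (c \<nu>) (u \<nu>)) else 0)" if "\<mu> \<in> \<Lambda>" for \<mu>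
  proof -
    have "(\<Prod>x\<leftarrow>ls. \<mu> - x) = 0" if "\<mu> \<noteq> \<nu>"
      using that \<open>\<mu> \<in> \<Lambda>\<close> assms(4) by (auto simp: prod_list_zero_iff)
    then show ?thesis
      using shift_prod_eigenvector[OF assms(2)[OF that], of ls] by (simp add: mult.commute)
  qed
  then show ?thesis
    unfolding act_sum_right using assms(1,3) by (simp cong: sum.cong)
qed

lemma eigenvectors_independent:
  assumes "finite \<Lambda>" "\<And>\<mu>. \<mu> \<in> \<Lambda> \<Longrightarrow> act K (u \<mu>) = cscale \<mu> (u \<mu>)" "\<And>\<mu>. \<mu> \<in> \<Lambda> \<Longrightarrow> u \<mu> \<noteq> 0"
  shows "inj_on u \<Lambda>" "cfun.independent (u ` \<Lambda>)"
proof -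
  show inj: "inj_on u \<Lambda>"
  proof (rule inj_onI)
    fix \<mu> \<nu> assume h: "\<mu> \<in> \<Lambda>" "\<nu> \<in> \<Lambda>" "u \<mu> = u \<nu>"
    then have "cscale \<mu> (u \<nu>) = cscale \<nu> (u \<nu>)"
      using assms(2)[OF h(1)] assms(2)[OF h(2)] by metis
    then show "\<mu> = \<nu>" using assms(3)[OF h(2)] by (simp only: cfun.scale_cancel_right) simp
  qed
  show "cfun.independent (u ` \<Lambda>)"
  proof
    assume "cfun.dependent (u ` \<Lambda>)"
    then obtain q \<nu> where q: "\<nu> \<in> \<Lambda>" "q (u \<nu>) \<noteq> 0" "(\<Sum>v\<in>u ` \<Lambda>. cscale (q v) v) = 0"
      using assms(1) by (auto simp: cfun.dependent_finite)
    obtain ls where ls: "set ls = \<Lambda> - {\<nu>}" using finite_list[of "\<Lambda> - {\<nu>}"] assms(1) by auto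
    have "(\<Sum>\<mu>\<in>\<Lambda>. cscale (q (u \<mu>)) (u \<mu>)) = 0"
      using q(3) by (simp add: sum.reindex[OF inj])
    then have "cscale (\<Prod>\<mu>\<leftarrow>ls. \<nu> - \<mu>) (cscale (q (u \<nu>)) (u \<nu>)) = 0"
      using shift_prod_kill_others[OF assms(1,2) q(1) ls, of "\<lambda>\<mu>. q (u \<mu>)"] by simp
    then show False
      using prod_list_diff_nonzero[of \<nu> ls] ls q assms(3) by simp
  qed
qed

definition spectrum_on :: "'a endo \<Rightarrow> ('a \<Rightarrow> complex) set \<Rightarrow> complex set" where
  "spectrum_on K V = {c. \<exists>v\<in>V. v \<noteq> 0 \<and> act K v = cscale c v}"

text \<open>
  By the decomposition into eigenvectors, \<open>V\<close> is spanned by one eigenvector for each eigenvalue.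
\<close>

lemma card_spectrum_of_simple_on:
  assumes V: "cfun.subspace V" "\<And>x. x \<in> V \<Longrightarrow> act K x \<in> V"
    and simple: "simple_on K V ls" and B: "B \<subseteq> V" "cfun.independent B"
  shows "card B \<le> card (spectrum_on K V)"
proof -
  define S where "S = spectrum_on K V"
  have "\<forall>c\<in>S. \<exists>v\<in>V. v \<noteq> 0 \<and> act K v = cscale c v" by (simp add: S_def spectrum_on_def)
  then obtain u where u: "\<And>c. c \<in> S \<Longrightarrow> u c \<in> V \<and> u c \<noteq> 0 \<and> act K (u c) = cscale c (u c)"
    by metis
  have fin: "finite S"
    by (rule finite_subset[of _ "set ls"])
       (use simple_on_eigenvalue[OF simple] in \<open>auto simp: S_def spectrum_on_def\<close>)
  have "V \<subseteq> cfun.span (u ` S)"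
  proof
    fix x assume x: "x \<in> V"
    obtain y where y: "\<forall>\<mu>\<in>set ls. y \<mu> \<in> V \<and> act K (y \<mu>) = cscale \<mu> (y \<mu>)" "x = (\<Sum>\<mu>\<in>set ls. y \<mu>)"
      using eigenvector_decomposition[OF V x, of ls] simple x by (auto simp: simple_on_def)
    have "y \<mu> \<in> cfun.span (u ` S)" if "\<mu> \<in> set ls" for \<mu>
    proof (cases "y \<mu> = 0")
      case False
      then have "\<mu> \<in> S" using y that by (auto simp: S_def spectrum_on_def)
      then have "\<exists>a. y \<mu> = cscale a (u \<mu>)"
        using simple u[of \<mu>] y(1) that unfolding simple_on_def by blast
      then obtain a where "y \<mu> = cscale a (u \<mu>)" by blast
      then show ?thesis using \<open>\<mu> \<in> S\<close> by (simp add: cfun.span_base cfun.span_scale)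
    qed (simp add: cfun.span_zero)
    then show "x \<in> cfun.span (u ` S)" unfolding y(2) by (rule cfun.span_sum)
  qed
  then have "card B \<le> card (u ` S)"
    using cfun.independent_span_bound[of "u ` S" B] fin B by auto
  also have "\<dots> \<le> card S" by (rule card_image_le[OF fin])
  finally show ?thesis by (simp add: S_def)
qed

text \<open>
  The hypotheses force the eigenvectors of \<open>K\<close> to form a basis of \<open>V\<close> with pairwise different
  eigenvalues. Operators that commute with \<open>K\<close> preserve its eigenlines, hence are diagonal in this
  basis; and since \<open>K\<close> is a combination of the \<open>H\<^sub>i\<close>, equal tuples of eigenvalues would give equal
  eigenvalues of \<open>K\<close>.
\<close>

lemma simple_spectrum_of_card:
  assumes V: "cfun.subspace V" and B: "finite B" "cfun.span B = V"
    and card: "card B \<le> card (spectrum_on K V)" and fin: "finite (spectrum_on K V)"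
    and H: "\<And>i x. i \<in> I \<Longrightarrow> x \<in> V \<Longrightarrow> act (H i) x \<in> V"
    and comm: "\<And>i. i \<in> I \<Longrightarrow> K * H i = H i * K"
    and K: "\<exists>c. \<forall>x\<in>V. act K x = (\<Sum>i\<in>I. cscale (c i) (act (H i) x))"
  shows "simple_spectrum I (\<lambda>i. act (H i)) V"
proof -
  define S where "S = spectrum_on K V"
  have "\<forall>c\<in>S. \<exists>v\<in>V. v \<noteq> 0 \<and> act K v = cscale c v" by (simp add: S_def spectrum_on_def)
  then obtain u where u: "\<And>c. c \<in> S \<Longrightarrow> u c \<in> V" "\<And>c. c \<in> S \<Longrightarrow> u c \<noteq> 0"
      "\<And>c. c \<in> S \<Longrightarrow> act K (u c) = cscale c (u c)"
    by metis
  have finS: "finite S" using fin by (simp add: S_def)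
  have inj: "inj_on u S" and ind: "cfun.independent (u ` S)"
    using eigenvectors_independent[OF finS u(3) u(2)] by auto
  have "card (u ` S) = card S" by (rule card_image[OF inj])
  have span: "cfun.span (u ` S) = V"
  proof
    show "cfun.span (u ` S) \<subseteq> V" using u(1) V by (intro cfun.span_minimal) auto
    show "V \<subseteq> cfun.span (u ` S)"
    proof (rule ccontr)
      assume "\<not> V \<subseteq> cfun.span (u ` S)"
      then obtain x where x: "x \<in> V" "x \<notin> cfun.span (u ` S)" by auto
      then have "cfun.independent (insert x (u ` S))" using ind by (simp add: cfun.independent_insert)
      moreover have "insert x (u ` S) \<subseteq> cfun.span B" using x u(1) B by auto
      ultimately have "card (insert x (u ` S)) \<le> card B"
        using cfun.independent_span_bound[OF B(1)] by blast
      moreover have "x \<notin> u ` S" using x(2) cfun.span_base by blast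
      ultimately show False using card \<open>card (u ` S) = card S\<close> finS by (simp add: S_def)
    qed
  qed
  have line: "\<exists>a. w = cscale a (u \<nu>)" if w: "w \<in> V" "act K w = cscale \<nu> w" and nu: "\<nu> \<in> S" for w \<nu>
  proof -
    obtain q where "w = (\<Sum>v\<in>u ` S. cscale (q v) v)"
      using w(1) finS unfolding span[symmetric] by (auto simp: cfun.span_finite)
    then have q: "w = (\<Sum>\<mu>\<in>S. cscale (q (u \<mu>)) (u \<mu>))" by (simp add: sum.reindex[OF inj])
    obtain ls where ls: "set ls = S - {\<nu>}" using finite_list[of "S - {\<nu>}"] finS by auto
    have "cscale (\<Prod>\<mu>\<leftarrow>ls. \<nu> - \<mu>) w = cscale (\<Prod>\<mu>\<leftarrow>ls. \<nu> - \<mu>) (cscale (q (u \<nu>)) (u \<nu>))"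
      using shift_prod_kill_others[OF finS u(3) nu ls, of "\<lambda>\<mu>. q (u \<mu>)"]
        shift_prod_eigenvector[OF w(2), of ls] q by simp
    then have "w = cscale (q (u \<nu>)) (u \<nu>)"
      using prod_list_diff_nonzero[of \<nu> ls] ls by (simp only: cfun.scale_cancel_left) auto
    then show ?thesis by blast
  qed
  have "\<exists>a. act (H i) (u \<nu>) = cscale a (u \<nu>)" if "i \<in> I" "\<nu> \<in> S" for i \<nu>
  proof (rule line)
    show "act (H i) (u \<nu>) \<in> V" using H u that by auto
    have "act (K * H i) (u \<nu>) = act (H i * K) (u \<nu>)" using comm that by simp
    then show "act K (act (H i) (u \<nu>)) = cscale \<nu> (act (H i) (u \<nu>))" using u that by simp
  qed fact
  then obtain e where e: "\<And>i \<nu>. i \<in> I \<Longrightarrow> \<nu> \<in> S \<Longrightarrow> act (H i) (u \<nu>) = cscale (e i \<nu>) (u \<nu>)"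
    by metis
  obtain c where c: "\<And>x. x \<in> V \<Longrightarrow> act K x = (\<Sum>i\<in>I. cscale (c i) (act (H i) x))" using K by auto
  have lam: "\<nu> = (\<Sum>i\<in>I. c i * e i \<nu>)" if "\<nu> \<in> S" for \<nu>
  proof -
    have "cscale \<nu> (u \<nu>) = (\<Sum>i\<in>I. cscale (c i) (act (H i) (u \<nu>)))"
      using c[OF u(1)[OF that]] u(3)[OF that] by simp
    also have "\<dots> = cscale (\<Sum>i\<in>I. c i * e i \<nu>) (u \<nu>)"
      using e that by (simp add: cfun.scale_sum_left)
    finally show ?thesis using u(2)[OF that] by (simp add: cfun.scale_right_imp_eq)
  qed
  define g where "g = the_inv_into S u"
  have g: "g (u \<nu>) = \<nu>" if "\<nu> \<in> S" for \<nu> using that inj by (simp add: g_def the_inv_into_f_f)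
  show ?thesis
    unfolding simple_spectrum_def
  proof (intro exI[of _ "u ` S"] exI[of _ "\<lambda>b i. e i (g b)"] conjI ballI impI)
    show "\<And>b i. b \<in> u ` S \<Longrightarrow> i \<in> I \<Longrightarrow> act (H i) b = cscale (e i (g b)) b" using e g by auto
    fix b b' assume "b \<in> u ` S" "b' \<in> u ` S" "b \<noteq> b'"
    then obtain \<mu> \<nu> where h: "\<mu> \<in> S" "\<nu> \<in> S" "b = u \<mu>" "b' = u \<nu>" "\<mu> \<noteq> \<nu>" by auto
    show "\<exists>i\<in>I. e i (g b) \<noteq> e i (g b')"
    proof (rule ccontr)
      assume "\<not> ?thesis"
      then have "\<And>i. i \<in> I \<Longrightarrow> e i \<mu> = e i \<nu>" using h g by auto
      then have "(\<Sum>i\<in>I. c i * e i \<mu>) = (\<Sum>i\<in>I. c i * e i \<nu>)" by simp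
      then show False using lam h by metis
    qed
  qed (use ind span in auto)
qed

section \<open>The discriminant of an operator\<close>

text \<open>
  Up to sign the discriminant of the characteristic polynomial.
\<close>

definition discr :: "complex mat \<Rightarrow> complex" where
  "discr M = resultant (char_poly M) (pderiv (char_poly M))"

text \<open>
  A common root of \<open>p\<close> and its derivative is a multiple root, and a root counted twice leaves too few
  different ones.
\<close>

lemma degree_gcd_pderiv_iff:
  fixes p :: "complex poly"
  assumes "p \<noteq> 0"
  shows "degree (gcd p (pderiv p)) = 0 \<longleftrightarrow> card {x. poly p x = 0} = degree p"
proof
  assume deg: "degree (gcd p (pderiv p)) = 0"
  have "\<not> (poly p a = 0 \<and> poly (pderiv p) a = 0)" for a
  proof
    assume "poly p a = 0 \<and> poly (pderiv p) a = 0"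
    then have "[:-a, 1:] dvd gcd p (pderiv p)" by (simp add: poly_eq_0_iff_dvd)
    then have "degree [:-a, 1:] \<le> degree (gcd p (pderiv p))"
      using assms by (intro dvd_imp_degree_le) auto
    then show False using deg by simp
  qed
  then have "rsquarefree p" by (simp add: rsquarefree_roots)
  then have "p = Polynomial.smult (lead_coeff p) (\<Prod>z|poly p z = 0. [:-z, 1:])"
    by (rule complex_poly_decompose_rsquarefree[symmetric])
  then have "degree p = degree (\<Prod>z|poly p z = 0. [:-z, 1:])"
    using assms by (metis degree_smult_eq leading_coeff_0_iff)
  also have "\<dots> = card {z. poly p z = 0}"
    by (subst degree_prod_sum_eq) auto
  finally show "card {x. poly p x = 0} = degree p" by simp
next
  assume card: "card {x. poly p x = 0} = degree p"
  show "degree (gcd p (pderiv p)) = 0"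
  proof (rule ccontr)
    assume "degree (gcd p (pderiv p)) \<noteq> 0"
    then obtain a where "poly (gcd p (pderiv p)) a = 0"
      using fundamental_theorem_of_algebra[of "gcd p (pderiv p)"] by (auto simp: constant_degree)
    then have dvd: "[:-a, 1:] dvd gcd p (pderiv p)" by (simp add: poly_eq_0_iff_dvd)
    then have "[:-a, 1:] dvd p" by (rule dvd_trans) (rule gcd_dvd1)
    then obtain q where q: "p = [:-a, 1:] * q" by (auto simp only: dvd_def)
    have "[:-a, 1:] dvd pderiv p" using dvd by (rule dvd_trans) (rule gcd_dvd2)
    then have "poly (pderiv p) a = 0" by (simp add: poly_eq_0_iff_dvd)
    then have "poly q a = 0" unfolding q pderiv_mult by (simp add: pderiv_pCons)
    then obtain r where r: "q = [:-a, 1:] * r" by (auto simp only: poly_eq_0_iff_dvd dvd_def)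
    have r0: "r \<noteq> 0" using assms q r by auto
    have "degree p = degree r + 2"
      using r0 unfolding q r by (simp add: degree_mult_eq del: mult_pCons_left)
    moreover have "{x. poly p x = 0} = insert a {x. poly r x = 0}"
      unfolding q r by auto
    then have "card {x. poly p x = 0} \<le> Suc (card {x. poly r x = 0})"
      by (simp add: card_insert_if poly_roots_finite r0)
    moreover have "card {x. poly r x = 0} \<le> degree r" by (rule card_poly_roots_bound[OF r0])
    ultimately show False using card by simp
  qed
qed

lemma discr_nonzero_iff:
  assumes M: "M \<in> carrier_mat d d"
  shows "discr M \<noteq> 0 \<longleftrightarrow> card {c. eigenvalue M c} = d"
proof -
  have "degree (char_poly M) = d" "char_poly M \<noteq> 0"
    using degree_monic_char_poly[OF M] by auto
  then show ?thesis
    using degree_gcd_pderiv_iff[of "char_poly M"]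
    by (simp add: discr_def resultant_0_gcd eigenvalue_root_char_poly[OF M])
qed

lemma card_eigenvalues_le:
  fixes M :: "complex mat"
  assumes M: "M \<in> carrier_mat d d"
  shows "finite {c. eigenvalue M c}" "card {c. eigenvalue M c} \<le> d"
proof -
  have "degree (char_poly M) = d" "char_poly M \<noteq> 0"
    using degree_monic_char_poly[OF M] by auto
  then show "finite {c. eigenvalue M c}" "card {c. eigenvalue M c} \<le> d"
    using poly_roots_finite card_poly_roots_bound[of "char_poly M"]
    by (auto simp: eigenvalue_root_char_poly[OF M])
qed

text \<open>
  The discriminant is a polynomial in the matrix entries. This is used twice: to see that it is
  polynomial in \<open>z\<close>, and that it is continuous along a path. Both are instances of the closure of an
  arbitrary algebra of functions under ``form the discriminant''.
\<close>

definition fun_algebra :: "('x \<Rightarrow> 'r::comm_ring_1) set \<Rightarrow> bool" where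
  "fun_algebra F \<longleftrightarrow> (\<forall>c. (\<lambda>x. c) \<in> F) \<and>
     (\<forall>f\<in>F. \<forall>g\<in>F. (\<lambda>x. f x + g x) \<in> F \<and> (\<lambda>x. f x * g x) \<in> F)"

lemma fun_algebraD:
  assumes "fun_algebra F"
  shows "(\<lambda>x. c) \<in> F" "f \<in> F \<Longrightarrow> g \<in> F \<Longrightarrow> (\<lambda>x. f x + g x) \<in> F"
    "f \<in> F \<Longrightarrow> g \<in> F \<Longrightarrow> (\<lambda>x. f x * g x) \<in> F"
  using assms by (auto simp: fun_algebra_def)

lemma fun_algebra_sum:
  assumes "fun_algebra F" "\<And>i. i \<in> I \<Longrightarrow> f i \<in> F"
  shows "(\<lambda>x. \<Sum>i\<in>I. f i x) \<in> F"
  using assms(2)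
  by (induction I rule: infinite_finite_induct) (simp_all add: fun_algebraD[OF assms(1)])

lemma fun_algebra_prod:
  assumes "fun_algebra F" "\<And>i. i \<in> I \<Longrightarrow> f i \<in> F"
  shows "(\<lambda>x. \<Prod>i\<in>I. f i x) \<in> F"
  using assms(2)
  by (induction I rule: infinite_finite_induct) (simp_all add: fun_algebraD[OF assms(1)])

lemma fun_algebra_det:
  assumes F: "fun_algebra F" and M: "\<And>x. M x \<in> carrier_mat d d"
    and entries: "\<And>i j. i < d \<Longrightarrow> j < d \<Longrightarrow> (\<lambda>x. M x $$ (i, j)) \<in> F"
  shows "(\<lambda>x. Determinant.det (M x)) \<in> F"
proof -
  have "(\<lambda>x. signof p * (\<Prod>i = 0..<d. M x $$ (i, p i))) \<in> F" if "p permutes {0..<d}" for p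
  proof (rule fun_algebraD(3)[OF F fun_algebraD(1)[OF F]])
    have "p i < d" if "i < d" for i
      using \<open>p permutes {0..<d}\<close> that permutes_in_image[of p "{0..<d}" i] by simp
    then show "(\<lambda>x. \<Prod>i = 0..<d. M x $$ (i, p i)) \<in> F"
      by (intro fun_algebra_prod[OF F] entries) auto
  qed
  then show ?thesis
    unfolding det_def'[OF M] by (intro fun_algebra_sum[OF F]) auto
qed

text \<open>
  With this algebra of families of polynomials, the characteristic polynomial is covered by the
  statement about determinants.
\<close>

lemma fun_algebra_poly:
  fixes F :: "('x \<Rightarrow> 'r::comm_ring_1) set"
  assumes F: "fun_algebra F"
  shows "fun_algebra {P :: 'x \<Rightarrow> 'r poly. \<forall>i. (\<lambda>x. coeff (P x) i) \<in> F}"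
proof -
  have "(\<lambda>x. coeff (P x * Q x) i) \<in> F"
    if "\<forall>i. (\<lambda>x. coeff (P x) i) \<in> F" "\<forall>i. (\<lambda>x. coeff (Q x) i) \<in> F" for P Q :: "'x \<Rightarrow> 'r poly" and i
    unfolding coeff_mult using that by (intro fun_algebra_sum[OF F] fun_algebraD(3)[OF F]) auto
  then show ?thesis using fun_algebraD(1,2)[OF F] by (simp add: fun_algebra_def)
qed

text \<open>
  The Sylvester matrix has the same size for all members of the family, as the characteristic
  polynomials all have degree \<open>d\<close>. So the resultant is a determinant of a family of matrices whose
  entries are coefficients or \<open>0\<close>.
\<close>

lemma fun_algebra_discr:
  assumes F: "fun_algebra F" and M: "\<And>x. M x \<in> carrier_mat d d"
    and entries: "\<And>i j. i < d \<Longrightarrow> j < d \<Longrightarrow> (\<lambda>x. M x $$ (i, j)) \<in> F"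
  shows "(\<lambda>x. discr (M x)) \<in> F"
proof -
  let ?FP = "{P. \<forall>i. (\<lambda>x. coeff (P x) i) \<in> F}"
  note const = fun_algebraD(1)[OF F]
  have "(\<lambda>x. char_poly_matrix (M x) $$ (i, j)) \<in> ?FP" if ij: "i < d" "j < d" for i j
  proof -
    have dims: "dim_row (M x) = d" "dim_col (M x) = d" for x using M[of x] by auto
    have "coeff (char_poly_matrix (M x) $$ (i, j)) k =
        (if i = j \<and> k = 1 then 1 else 0) + (if k = 0 then -1 else 0) * M x $$ (i, j)" for x k
      using ij by (cases k) (auto simp: char_poly_matrix_def dims coeff_pCons split: nat.splits)
    then show ?thesis
      using fun_algebraD(2)[OF F const fun_algebraD(3)[OF F const entries[OF ij]]] by simp
  qed
  then have "(\<lambda>x. char_poly (M x)) \<in> ?FP"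
    unfolding char_poly_def using M
    by (intro fun_algebra_det[OF fun_algebra_poly[OF F], of _ d]) auto
  then have coeffs: "(\<lambda>x. coeff (char_poly (M x)) i) \<in> F" for i by simp
  have dcoeffs: "(\<lambda>x. coeff (pderiv (char_poly (M x))) i) \<in> F" for i
    unfolding coeff_pderiv by (rule fun_algebraD(3)[OF F const coeffs])
  have deg: "degree (char_poly (M x)) = d" for x using degree_monic_char_poly[OF M] by simp
  have syl: "sylvester_mat (char_poly (M x)) (pderiv (char_poly (M x)))
      = sylvester_mat_sub d (d - 1) (char_poly (M x)) (pderiv (char_poly (M x)))" for x
    by (simp add: sylvester_mat_def deg degree_pderiv)
  show ?thesis
    unfolding discr_def resultant_def syl
  proof (rule fun_algebra_det[OF F sylvester_mat_sub_carrier])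
    fix i j assume "i < d + (d - 1)" "j < d + (d - 1)"
    then show "(\<lambda>x. sylvester_mat_sub d (d - 1) (char_poly (M x)) (pderiv (char_poly (M x))) $$ (i, j)) \<in> F"
      by (simp only: sylvester_mat_sub_index)
         (cases "i < d - 1"; cases "i \<le> j \<and> j - i \<le> d"; cases "i - (d - 1) \<le> j \<and> j \<le> i";
           simp only: if_True if_False simp_thms coeffs dcoeffs const)
  qed
qed

text \<open>
  The matrix of \<open>T\<close> in the basis \<open>b 0, \<dots>, b (d - 1)\<close> of a subspace which \<open>T\<close> preserves.
\<close>

definition endo_mat :: "nat \<Rightarrow> (nat \<Rightarrow> 'a \<Rightarrow> complex) \<Rightarrow> 'a endo \<Rightarrow> complex mat" where
  "endo_mat d b T = Matrix.mat d d (\<lambda>(r, s). cfun.representation (b ` {..<d}) (act T (b s)) (b r))"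

definition basis_of :: "nat \<Rightarrow> (nat \<Rightarrow> 'a \<Rightarrow> complex) \<Rightarrow> ('a \<Rightarrow> complex) set \<Rightarrow> bool" where
  "basis_of d b V \<longleftrightarrow> inj_on b {..<d} \<and> cfun.independent (b ` {..<d}) \<and> cfun.span (b ` {..<d}) = V"

lemma ex_basis_of:
  fixes V :: "('a \<Rightarrow> complex) set"
  assumes "cfun.subspace V" "finite S" "\<And>v x. v \<in> V \<Longrightarrow> v x \<noteq> 0 \<Longrightarrow> x \<in> S"
  shows "\<exists>d b. basis_of d b V"
proof -
  define \<delta> :: "'a \<Rightarrow> 'a \<Rightarrow> complex" where "\<delta> s x = (if x = s then 1 else 0)" for s x
  have "v \<in> cfun.span (\<delta> ` S)" if "v \<in> V" for v
  proof -
    have eq: "v x = (\<Sum>s\<in>S. cscale (v s) (\<delta> s) x)" for x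
      using assms(2) assms(3)[OF that, of x]
      by (auto simp: cscale_def \<delta>_def if_distrib cong: if_cong)
    have "v = (\<Sum>s\<in>S. cscale (v s) (\<delta> s))" by (rule ext, subst sum_fun_apply, rule eq)
    also have "\<dots> \<in> cfun.span (\<delta> ` S)"
      by (intro cfun.span_sum cfun.span_scale cfun.span_base) auto
    finally show ?thesis .
  qed
  then have sub: "V \<subseteq> cfun.span (\<delta> ` S)" by blast
  obtain B where B: "B \<subseteq> V" "cfun.independent B" "V \<subseteq> cfun.span B"
    by (rule cfun.maximal_independent_subset)
  have fin: "finite B"
    using cfun.independent_span_bound[of "\<delta> ` S" B] assms(2) B sub by auto
  obtain b where b: "bij_betw b {0..<card B} B" using ex_bij_betw_nat_finite[OF fin] by blast
  then have "inj_on b {..<card B}" "b ` {..<card B} = B"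
    by (auto simp: bij_betw_def lessThan_atLeast0)
  moreover have "cfun.span B = V" using B assms(1) cfun.span_minimal by blast
  ultimately have "basis_of (card B) b V" using B by (simp add: basis_of_def)
  then show ?thesis by blast
qed

lemma endo_mat_carrier [simp]: "endo_mat d b T \<in> carrier_mat d d"
  by (simp add: endo_mat_def)

lemma basis_of_sum_eq_0:
  assumes "basis_of d b V" "(\<Sum>r<d. cscale (c r) (b r)) = 0" "r < d"
  shows "c r = 0"
proof (rule ccontr)
  assume "c r \<noteq> 0"
  define g where "g = the_inv_into {..<d} b"
  have inj: "inj_on b {..<d}" using assms(1) by (simp add: basis_of_def)
  have g: "g (b s) = s" if "s < d" for s using inj that by (simp add: g_def the_inv_into_f_f)
  have "(\<Sum>v\<in>b ` {..<d}. cscale (c (g v)) v) = 0"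
    using assms(2) by (simp add: sum.reindex[OF inj] g)
  moreover have "c (g (b r)) \<noteq> 0" using g assms(3) \<open>c r \<noteq> 0\<close> by simp
  ultimately have "cfun.dependent (b ` {..<d})"
    using assms(3) by (subst cfun.dependent_finite) (auto intro!: exI[of _ "\<lambda>v. c (g v)"])
  then show False using assms(1) by (simp add: basis_of_def)
qed

lemma basis_of_representation:
  assumes "basis_of d b V" "v \<in> V"
  shows "(\<Sum>r<d. cscale (cfun.representation (b ` {..<d}) v (b r)) (b r)) = v"
  using assms cfun.sum_representation_eq[of "b ` {..<d}" v "b ` {..<d}"]
  by (simp add: basis_of_def sum.reindex)

lemma act_endo_mat:
  assumes b: "basis_of d b V" and T: "\<And>v. v \<in> V \<Longrightarrow> act T v \<in> V" and x: "dim_vec x = d"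
  shows "act T (\<Sum>s<d. cscale (vec_index x s) (b s))
    = (\<Sum>r<d. cscale (vec_index (endo_mat d b T *\<^sub>v x) r) (b r))"
proof -
  have bV: "b s \<in> V" if "s < d" for s
    using b that cfun.span_base[of "b s" "b ` {..<d}"] by (auto simp: basis_of_def)
  let ?R = "\<lambda>r s. cfun.representation (b ` {..<d}) (act T (b s)) (b r)"
  have "act T (\<Sum>s<d. cscale (vec_index x s) (b s))
      = (\<Sum>s<d. cscale (vec_index x s) (\<Sum>r<d. cscale (?R r s) (b r)))"
    unfolding act_sum_right
    by (intro sum.cong refl) (simp add: basis_of_representation[OF b T[OF bV]])
  also have "\<dots> = (\<Sum>s<d. \<Sum>r<d. cscale (?R r s * vec_index x s) (b r))"
    by (simp add: cfun.scale_sum_right mult.commute)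
  also have "\<dots> = (\<Sum>r<d. cscale (\<Sum>s<d. ?R r s * vec_index x s) (b r))"
    by (subst sum.swap) (simp add: cfun.scale_sum_left)
  also have "\<dots> = (\<Sum>r<d. cscale (vec_index (endo_mat d b T *\<^sub>v x) r) (b r))"
    using x by (intro sum.cong refl)
      (auto simp: endo_mat_def scalar_prod_def lessThan_atLeast0)
  finally show ?thesis .
qed

lemma eigenvalue_endo_mat:
  assumes b: "basis_of d b V" and T: "\<And>v. v \<in> V \<Longrightarrow> act T v \<in> V"
  shows "{c. eigenvalue (endo_mat d b T) c} = spectrum_on T V"
proof (rule subset_antisym; rule subsetI)
  fix c assume "c \<in> {c. eigenvalue (endo_mat d b T) c}"
  then obtain x where "eigenvector (endo_mat d b T) x c"
    by (auto simp only: eigenvalue_def mem_Collect_eq)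
  then have x: "dim_vec x = d" "x \<noteq> 0\<^sub>v d" "endo_mat d b T *\<^sub>v x = c \<cdot>\<^sub>v x"
    unfolding eigenvector_def by (auto simp: endo_mat_def)
  let ?v = "\<Sum>s<d. cscale (vec_index x s) (b s)"
  have "?v \<in> cfun.span (b ` {..<d})"
    by (intro cfun.span_sum cfun.span_scale cfun.span_base) auto
  then have "?v \<in> V" using b by (simp add: basis_of_def)
  moreover have "?v \<noteq> 0"
  proof
    assume "?v = 0"
    then have "vec_index x r = 0" if "r < d" for r using basis_of_sum_eq_0[OF b _ that] by blast
    then have "x = 0\<^sub>v d" using x(1) by (intro eq_vecI) auto
    then show False using x(2) by simp
  qed
  moreover have "act T ?v = cscale c ?v"
  proof -
    have "act T ?v = (\<Sum>r<d. cscale (vec_index (c \<cdot>\<^sub>v x) r) (b r))"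
      using act_endo_mat[OF b T x(1)] unfolding x(3) .
    also have "\<dots> = cscale c ?v"
      unfolding cfun.scale_sum_right using x(1) by (intro sum.cong refl) simp
    finally show ?thesis .
  qed
  ultimately show "c \<in> spectrum_on T V" unfolding spectrum_on_def by blast
next
  fix c assume "c \<in> spectrum_on T V"
  then obtain v where v: "v \<in> V" "v \<noteq> 0" "act T v = cscale c v" by (auto simp: spectrum_on_def)
  define x where "x = Matrix.vec d (\<lambda>r. cfun.representation (b ` {..<d}) v (b r))"
  have dx: "dim_vec x = d" by (simp add: x_def)
  have vx: "(\<Sum>s<d. cscale (vec_index x s) (b s)) = v"
    using basis_of_representation[OF b v(1)] by (simp add: x_def)
  let ?y = "endo_mat d b T *\<^sub>v x"
  have "(\<Sum>r<d. cscale (vec_index ?y r - c * vec_index x r) (b r))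
      = act T (\<Sum>s<d. cscale (vec_index x s) (b s)) - cscale c (\<Sum>s<d. cscale (vec_index x s) (b s))"
    by (subst act_endo_mat[OF b T dx])
       (simp_all add: cfun.scale_left_diff_distrib sum_subtractf cfun.scale_sum_right)
  then have "(\<Sum>r<d. cscale (vec_index ?y r - c * vec_index x r) (b r)) = 0"
    using v(3) by (simp add: vx)
  then have "vec_index ?y r - c * vec_index x r = 0" if "r < d" for r
    by (rule basis_of_sum_eq_0[OF b _ that])
  then have "?y = c \<cdot>\<^sub>v x"
    using dx by (intro eq_vecI) (simp_all add: endo_mat_def del: index_mult_mat_vec)
  moreover have "x \<noteq> 0\<^sub>v d"
  proof
    assume "x = 0\<^sub>v d"
    then have "(\<Sum>s<d. cscale (vec_index x s) (b s)) = 0" by (intro sum.neutral) simp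
    then show False using v(2) vx by simp
  qed
  ultimately have "eigenvector (endo_mat d b T) x c"
    unfolding eigenvector_def using dx by (auto simp: endo_mat_def)
  then show "c \<in> {c. eigenvalue (endo_mat d b T) c}" by (auto simp only: eigenvalue_def mem_Collect_eq)
qed

text \<open>
  Both sides say that there are \<open>d\<close> different eigenvalues, the largest possible number.
\<close>

lemma discr_endo_mat_nonzero_iff:
  assumes b: "basis_of d b V" and T: "\<And>v. v \<in> V \<Longrightarrow> act T v \<in> V"
  shows "discr (endo_mat d b T) \<noteq> 0 \<longleftrightarrow> d \<le> card (spectrum_on T V)" "finite (spectrum_on T V)"
proof -
  note ev = eigenvalue_endo_mat[OF b T, symmetric]
  show "discr (endo_mat d b T) \<noteq> 0 \<longleftrightarrow> d \<le> card (spectrum_on T V)"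
    using discr_nonzero_iff[OF endo_mat_carrier, of d b T]
      card_eigenvalues_le(2)[OF endo_mat_carrier, of d b T] ev by auto
  show "finite (spectrum_on T V)"
    using card_eigenvalues_le(1)[OF endo_mat_carrier, of d b T] ev by simp
qed

lemma endo_mat_linear_comb:
  assumes b: "basis_of d b V" and T: "\<And>p v. p \<in> P \<Longrightarrow> v \<in> V \<Longrightarrow> act (T p) v \<in> V"
    and rs: "r < d" "s < d"
  shows "endo_mat d b (\<Sum>p\<in>P. scal (\<alpha> p) * T p) $$ (r, s) = (\<Sum>p\<in>P. \<alpha> p * endo_mat d b (T p) $$ (r, s))"
proof -
  let ?B = "b ` {..<d}"
  have ind: "cfun.independent ?B" and span: "cfun.span ?B = V" using b by (auto simp: basis_of_def)
  have bV: "b s \<in> V" using rs cfun.span_base[of "b s" ?B] span by auto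
  have TV: "act (T p) (b s) \<in> cfun.span ?B" if "p \<in> P" for p using T[OF that bV] span by simp
  have "cfun.representation ?B (\<Sum>p\<in>P. cscale (\<alpha> p) (act (T p) (b s))) =
      (\<lambda>v. \<Sum>p\<in>P. cfun.representation ?B (cscale (\<alpha> p) (act (T p) (b s))) v)"
    by (intro cfun.representation_sum ind cfun.span_scale TV)
  also have "\<dots> = (\<lambda>v. \<Sum>p\<in>P. \<alpha> p * cfun.representation ?B (act (T p) (b s)) v)"
    by (intro ext sum.cong refl) (simp add: cfun.representation_scale[OF ind TV])
  finally show ?thesis using rs by (simp add: endo_mat_def)
qed

section \<open>Singular vectors in the first factors\<close>

definition supported :: "'a set \<Rightarrow> ('a \<Rightarrow> complex) set" where
  "supported A = {w. \<forall>a. w a \<noteq> 0 \<longrightarrow> a \<in> A}"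

lemma supportedD: "w \<in> supported A \<Longrightarrow> a \<notin> A \<Longrightarrow> w a = 0"
  by (auto simp: supported_def)

lemma subspace_supported: "cfun.subspace (supported A)"
  unfolding cfun.subspace_def supported_def cscale_def by (auto, metis add.right_neutral)

text \<open>
  The basis vectors of weight \<open>\<Sum>\<^bsub>i \<le> p\<^esub> m i - 2 \<kappa>\<close> in the first \<open>p\<close> tensor factors, which are embedded into
  the full tensor product by putting the highest weight vector \<open>v\<^sub>0\<close> into the other factors. So all
  stages of the induction on \<open>p\<close> live in one space and use the same operators. The number \<open>\<kappa>\<close> is an
  integer so that \<open>e\<close> and \<open>f\<close> shift it without truncation.
\<close>

definition level :: "nat \<Rightarrow> (nat \<Rightarrow> nat) \<Rightarrow> nat \<Rightarrow> int \<Rightarrow> (nat \<Rightarrow> nat) set" where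
  "level n m p \<kappa> = {a \<in> tensor_index n m. (\<forall>i\<in>{p<..n}. a i = 0) \<and> (\<Sum>i\<in>{1..n}. int (a i)) = \<kappa>}"

lemma tensor_index_upd:
  assumes "i \<in> {1..n}"
  shows "a(i := r) \<in> tensor_index n m \<and> a i \<le> m i \<longleftrightarrow> a \<in> tensor_index n m \<and> r \<le> m i"
  using assms by (auto simp: tensor_index_def PiE_iff extensional_def split: if_splits)

lemma sum_upd:
  assumes "i \<in> {1..n::nat}"
  shows "(\<Sum>j\<in>{1..n}. int ((a(i := r)) j)) = (\<Sum>j\<in>{1..n}. int (a j)) + int r - int (a i)"
  using assms by (subst (1 2) sum.remove[of _ i]) auto

lemma level_upd:
  assumes "i \<in> {1..p}" "p \<le> n" "a(i := r) \<in> level n m p \<kappa>" "a i \<le> m i"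
  shows "a \<in> level n m p (\<kappa> + int (a i) - int r)"
proof -
  have i: "i \<in> {1..n}" using assms by auto
  have "a \<in> tensor_index n m" using tensor_index_upd[OF i, of a r m] assms(3,4) by (simp add: level_def)
  moreover have "a j = 0" if "j \<in> {p<..n}" for j
    using assms(1,3) that by (auto simp: level_def split: if_splits)
  ultimately show ?thesis using assms(3) sum_upd[OF i, of a r] by (simp add: level_def)
qed

lemma op_supported:
  assumes "w \<in> supported (level n m p \<kappa>)" "i \<in> {1..p}" "p \<le> n"
  shows "act (opE m i) w \<in> supported (level n m p (\<kappa> - 1))"
    "act (opF m i) w \<in> supported (level n m p (\<kappa> + 1))"
    "act (opH m i) w \<in> supported (level n m p \<kappa>)"
proof -
  show "act (opE m i) w \<in> supported (level n m p (\<kappa> - 1))"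
    using level_upd[OF assms(2,3), of _ "_ + 1" m \<kappa>] assms(1)
    by (fastforce simp: supported_def op_apply split: if_splits)
  show "act (opF m i) w \<in> supported (level n m p (\<kappa> + 1))"
    unfolding supported_def
  proof (safe)
    fix a assume "act (opF m i) w a \<noteq> 0"
    then have a: "1 \<le> a i" "a i \<le> m i" "w (a(i := a i - 1)) \<noteq> 0" by (auto simp: op_apply split: if_splits)
    then have "a(i := a i - 1) \<in> level n m p \<kappa>" using assms(1) by (auto simp: supported_def)
    from level_upd[OF assms(2,3) this a(2)] show "a \<in> level n m p (\<kappa> + 1)"
      using a(1) by (simp add: of_nat_diff)
  qed
  show "act (opH m i) w \<in> supported (level n m p \<kappa>)"
    using assms(1) by (auto simp: supported_def op_apply split: if_splits)
qed

lemma Om_supported: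
  assumes "w \<in> supported (level n m p \<kappa>)" "i \<in> {1..p}" "j \<in> {1..p}" "p \<le> n"
  shows "act (Om m i j) w \<in> supported (level n m p \<kappa>)"
proof -
  note S = subspace_supported[of "level n m p \<kappa>"]
  have "act (opE m i) (act (opF m j) w) \<in> supported (level n m p \<kappa>)"
    using op_supported(1)[OF op_supported(2)[OF assms(1,3,4)] assms(2,4)] by simp
  moreover have "act (opF m i) (act (opE m j) w) \<in> supported (level n m p \<kappa>)"
    using op_supported(2)[OF op_supported(1)[OF assms(1,3,4)] assms(2,4)] by simp
  moreover have "act (opH m i) (act (opH m j) w) \<in> supported (level n m p \<kappa>)"
    using op_supported(3)[OF op_supported(3)[OF assms(1,3,4)] assms(2,4)] by simp
  ultimately show ?thesis
    by (simp add: Om_def cfun.subspace_add[OF S] cfun.subspace_scale[OF S])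
qed

definition Sing_upto :: "nat \<Rightarrow> (nat \<Rightarrow> nat) \<Rightarrow> nat \<Rightarrow> int \<Rightarrow> tensor set" where
  "Sing_upto n m p \<kappa> = {w \<in> supported (level n m p \<kappa>). act (\<Sum>i\<in>{1..p}. opE m i) w = 0}"

lemma subspace_sing: "cfun.subspace (Sing_upto n m p \<kappa>)"
  using subspace_supported[of "level n m p \<kappa>"]
  unfolding cfun.subspace_def Sing_upto_def by (simp del: act_sum act_simps)

lemma Om_sing:
  assumes "w \<in> Sing_upto n m p \<kappa>" "i \<in> {1..p}" "j \<in> {1..p}" "i \<noteq> j" "p \<le> n"
  shows "act (Om m i j) w \<in> Sing_upto n m p \<kappa>"
proof -
  have "act (commutator (Om m i j) (\<Sum>i\<in>{1..p}. opE m i)) w = 0"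
    using commutator_Om_total[of i j "{1..p}" opE m] assms(2-4) by simp
  then have "act (\<Sum>i\<in>{1..p}. opE m i) (act (Om m i j) w) = 0"
    using assms(1) by (simp add: commutator_def Sing_upto_def del: act_sum)
  then show ?thesis using assms Om_supported by (simp add: Sing_upto_def del: act_sum)
qed

lemma weight_level:
  assumes w: "w \<in> supported (level n m p \<kappa>)" and p: "p \<le> n"
  shows "act (\<Sum>i\<in>{1..p}. opH m i) w = cscale (of_int ((\<Sum>i\<in>{1..p}. int (m i)) - 2 * \<kappa>)) w"
proof
  fix a
  show "act (\<Sum>i\<in>{1..p}. opH m i) w a = cscale (of_int ((\<Sum>i\<in>{1..p}. int (m i)) - 2 * \<kappa>)) w a"
  proof (cases "w a = 0")
    case True
    then show ?thesis unfolding act_sum sum_fun_apply by (simp add: op_apply cscale_def sum.neutral)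
  next
    case False
    then have a: "a \<in> level n m p \<kappa>" using w by (auto simp: supported_def)
    have "\<kappa> = (\<Sum>i\<in>{1..n}. int (a i))" using a by (simp add: level_def)
    also have "\<dots> = (\<Sum>i\<in>{1..p}. int (a i))"
      using a p by (intro sum.mono_neutral_right) (auto simp: level_def)
    finally have kappa: "\<kappa> = (\<Sum>i\<in>{1..p}. int (a i))" .
    have "a i \<le> m i" if "i \<in> {1..p}" for i
      using a that p by (auto simp: level_def tensor_index_def)
    then have "act (\<Sum>i\<in>{1..p}. opH m i) w a = (\<Sum>i\<in>{1..p}. (of_nat (m i) - 2 * of_nat (a i)) * w a)"
      unfolding act_sum sum_fun_apply by (intro sum.cong refl) (simp add: op_apply)
    also have "\<dots> = of_int ((\<Sum>i\<in>{1..p}. int (m i)) - 2 * \<kappa>) * w a"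
      by (simp add: kappa sum_distrib_right[symmetric] sum_subtractf sum_distrib_left)
    finally show ?thesis by (simp add: cscale_def)
  qed
qed

lemma commutator_total: "commutator (\<Sum>i\<in>{1..p}. opE m i) (\<Sum>i\<in>{1..p}. opF m i) = (\<Sum>i\<in>{1..p}. opH m i)"
proof -
  have "(\<Sum>j\<in>{1..p}. commutator (opE m i) (opF m j)) = opH m i" if "i \<in> {1..p}" for i
  proof -
    have "(\<Sum>j\<in>{1..p}. commutator (opE m i) (opF m j)) = (\<Sum>j\<in>{1..p}. if j = i then opH m i else 0)"
      by (intro sum.cong refl) (simp add: commutator_same_factor commutator_other_factor)
    then show ?thesis using that by simp
  qed
  then show ?thesis unfolding commutator_sum(1) by (intro sum.cong refl) (simp only: commutator_sum(2))
qed

text \<open>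
  If \<open>e u = 0\<close> and \<open>h u = \<mu> u\<close>, then \<open>e f\<^bsup>N+1\<^esup> u = (N + 1) (\<mu> - N) f\<^bsup>N\<^esup> u\<close>. For \<open>\<mu> < 0\<close> the factor never
  vanishes, whereas \<open>f\<^bsup>N\<^esup> u = 0\<close> for large \<open>N\<close>.
\<close>

lemma sing_negative_weight:
  assumes u: "u \<in> Sing_upto n m p \<kappa>" and p: "p \<le> n" and neg: "(\<Sum>i\<in>{1..p}. int (m i)) - 2 * \<kappa> < 0"
  shows "u = 0"
proof -
  define e f h where "e = (\<Sum>i\<in>{1..p}. opE m i)" and "f = (\<Sum>i\<in>{1..p}. opF m i)"
    and "h = (\<Sum>i\<in>{1..p}. opH m i)"
  define \<mu> where "\<mu> = (\<Sum>i\<in>{1..p}. int (m i)) - 2 * \<kappa>"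
  define v where "v N = (act f ^^ N) u" for N
  have vS: "v (Suc N) = act f (v N)" for N by (simp add: v_def)
  have supp: "v N \<in> supported (level n m p (\<kappa> + int N))" for N
  proof (induction N)
    case 0
    then show ?case using u by (simp add: v_def Sing_upto_def)
  next
    case (Suc N)
    have "act f (v N) \<in> supported (level n m p (\<kappa> + int N + 1))"
      unfolding f_def act_sum
      by (intro cfun.subspace_sum[OF subspace_supported] op_supported(2)[OF Suc.IH _ p])
    moreover have "\<kappa> + int N + 1 = \<kappa> + int (Suc N)" by simp
    ultimately show ?case by (simp only: vS)
  qed
  have ef: "act e (act f x) = act f (act e x) + act h x" for x
  proof -
    have "act (commutator e f) x = act h x" by (simp only: e_def f_def h_def commutator_total)
    then have "act e (act f x) - act f (act e x) = act h x" by (simp only: commutator_def act_simps)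
    then show ?thesis by (simp only: diff_eq_eq add.commute)
  qed
  have e: "act e (v (Suc N)) = cscale (of_int (int (Suc N) * (\<mu> - int N))) (v N)" for N
  proof (induction N)
    case 0
    have "act h u = cscale (of_int \<mu>) u"
      using weight_level[of u n m p \<kappa>] u p by (simp add: h_def \<mu>_def Sing_upto_def del: act_sum)
    moreover have "act e u = 0" using u by (simp add: e_def Sing_upto_def del: act_sum)
    ultimately show ?case using ef[of u] by (simp add: v_def)
  next
    case (Suc N)
    have "act h (v (Suc N)) = cscale (of_int (\<mu> - 2 * int (Suc N))) (v (Suc N))"
      using weight_level[OF supp[of "Suc N"] p] by (simp add: h_def \<mu>_def algebra_simps del: act_sum)
    then have "act e (v (Suc (Suc N))) = cscale (of_int (int (Suc N) * (\<mu> - int N)) + of_int (\<mu> - 2 * int (Suc N))) (v (Suc N))"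
      unfolding vS[of "Suc N"] ef Suc.IH by (simp only: act_linear vS[symmetric] cfun.scale_left_distrib)
    moreover have "of_int (int (Suc N) * (\<mu> - int N)) + of_int (\<mu> - 2 * int (Suc N))
        = (of_int (int (Suc (Suc N)) * (\<mu> - int (Suc N))) :: complex)"
      by (simp add: algebra_simps)
    ultimately show ?case by simp
  qed
  have down: "v N = 0" if "v (Suc N) = 0" for N
  proof -
    have "cscale (of_int (int (Suc N) * (\<mu> - int N))) (v N) = 0" using e[of N] that by simp
    moreover have "int (Suc N) * (\<mu> - int N) \<noteq> 0" using neg by (simp add: \<mu>_def)
    then have "(of_int (int (Suc N) * (\<mu> - int N)) :: complex) \<noteq> 0" by (simp only: of_int_eq_0_iff) simp
    ultimately show ?thesis by (simp only: cscale_eq_0_iff) simp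
  qed
  \<comment> \<open>A power \<open>f\<^bsup>N\<^esup>\<close> that leads out of the finitely many levels.\<close>
  define N where "N = nat (\<bar>(\<Sum>i\<in>{1..n}. int (m i)) - \<kappa>\<bar> + 1)"
  have "v N a = 0" for a
  proof (rule supportedD[OF supp])
    show "a \<notin> level n m p (\<kappa> + int N)"
    proof
      assume "a \<in> level n m p (\<kappa> + int N)"
      then have "(\<Sum>i\<in>{1..n}. int (a i)) = \<kappa> + int N" "\<forall>i\<in>{1..n}. a i \<le> m i"
        by (auto simp: level_def tensor_index_def)
      moreover from this(2) have "(\<Sum>i\<in>{1..n}. int (a i)) \<le> (\<Sum>i\<in>{1..n}. int (m i))"
        by (intro sum_mono) auto
      ultimately show False unfolding N_def by linarith
    qed
  qed
  then have "v N = 0" by auto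
  then have "v 0 = 0"
  proof (induction N)
    case (Suc N)
    then show ?case using down by blast
  qed
  then show ?thesis by (simp add: v_def)
qed

section \<open>Simple spectrum of the asymptotic operators\<close>

text \<open>
  The coefficient of \<open>v\<^sub>s\<close> in the \<open>q\<close>-th factor, put back into the tensor product with \<open>v\<^sub>0\<close> in that place.
\<close>

lift_definition slice :: "nat \<Rightarrow> nat \<Rightarrow> (nat \<Rightarrow> nat) endo" is
  "\<lambda>q s w a. if a q = 0 then w (a(q := s)) else 0"
  by (auto simp: linear_cscale_iff fun_eq_iff cscale_def)

lemma slice_op:
  assumes "i \<noteq> q" "X \<in> {opE, opF, opH}"
  shows "act (slice q s) (act (X m i) w) = act (X m i) (act (slice q s) w)"
  using assms by (auto simp: fun_eq_iff slice.rep_eq op_apply fun_upd_twist)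

lemma slice_same:
  "act (slice q s) (act (opE m q) w)
     = (if s < m q then cscale (of_nat (s + 1) * (of_nat (m q) - of_nat s)) (act (slice q (s + 1)) w) else 0)"
  "act (slice q s) (act (opF m q) w) = (if 1 \<le> s \<and> s \<le> m q then act (slice q (s - 1)) w else 0)"
  "act (slice q s) (act (opH m q) w)
     = (if s \<le> m q then cscale (of_nat (m q) - 2 * of_nat s) (act (slice q s) w) else 0)"
  by (auto simp: fun_eq_iff slice.rep_eq op_apply cscale_def)

lemma slice_Om:
  assumes "i \<noteq> q" "j \<noteq> q"
  shows "act (slice q s) (act (Om m i j) w) = act (Om m i j) (act (slice q s) w)"
  using assms by (simp add: Om_def slice_op)

lemma slice_eq_0D:
  assumes "\<And>t. act (slice q t) w = 0" shows "w = 0"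
proof
  fix a
  have "act (slice q (a q)) w (a(q := 0)) = 0" using assms by simp
  then show "w a = 0 a" by (simp add: slice.rep_eq)
qed

lemma slice_supported:
  assumes "w \<in> supported (level n m (Suc p) \<kappa>)" "Suc p \<le> n"
  shows "act (slice (Suc p) s) w \<in> supported (level n m p (\<kappa> - int s))"
  unfolding supported_def
proof safe
  fix a assume "act (slice (Suc p) s) w a \<noteq> 0"
  then have a: "a (Suc p) = 0" "w (a(Suc p := s)) \<noteq> 0" by (auto simp: slice.rep_eq split: if_splits)
  then have "a(Suc p := s) \<in> level n m (Suc p) \<kappa>" using assms by (auto simp: supported_def)
  from level_upd[OF _ assms(2) this] have lev: "a \<in> level n m (Suc p) (\<kappa> - int s)" using a by simp
  have "a i = 0" if "i \<in> {p<..n}" for i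
    using lev a(1) that by (cases "i = Suc p") (auto simp: level_def)
  then show "a \<in> level n m p (\<kappa> - int s)" using lev by (simp add: level_def)
qed

lemma slice_beyond:
  assumes "w \<in> supported (level n m (Suc p) \<kappa>)" "Suc p \<le> n" "m (Suc p) < s"
  shows "act (slice (Suc p) s) w = 0"
proof
  fix a
  have "a(Suc p := s) \<notin> level n m (Suc p) \<kappa>"
  proof
    assume "a(Suc p := s) \<in> level n m (Suc p) \<kappa>"
    then have "a(Suc p := s) \<in> (\<Pi>\<^sub>E i\<in>{1..n}. {0..m i})" by (simp only: level_def tensor_index_def mem_Collect_eq)
    then have "(a(Suc p := s)) (Suc p) \<in> {0..m (Suc p)}" by (rule PiE_mem) (use assms(2) in simp)
    then have "(a(Suc p := s)) (Suc p) \<le> m (Suc p)" by simp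
    then show False using assms(3) by simp
  qed
  then show "act (slice (Suc p) s) w a = 0 a" using assms(1) by (auto simp: slice.rep_eq supported_def)
qed

lemma lowering_slice:
  assumes w: "w \<in> Sing_upto n m (Suc p) \<kappa>"
  shows "act (\<Sum>i\<in>{1..p}. opE m i) w = - act (opE m (Suc p)) w"
proof -
  have "act (\<Sum>i\<in>{1..Suc p}. opE m i) w = 0" using w by (simp add: Sing_upto_def del: act_sum)
  then show ?thesis by (simp add: eq_neg_iff_add_eq_0)
qed

lemma slice_total:
  assumes "X \<in> {opE, opF, opH}"
  shows "act (slice (Suc p) s) (act (\<Sum>i\<in>{1..p}. X m i) w)
    = act (\<Sum>i\<in>{1..p}. X m i) (act (slice (Suc p) s) w)"
  unfolding act_sum act_sum_right by (rule sum.cong[OF refl], rule slice_op[OF _ assms]) simp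

text \<open>
  The component of \<open>e w = 0\<close> at \<open>v\<^sub>s\<close> expresses \<open>e\<close> of the \<open>s\<close>-th coefficient by the next one, which is
  \<open>0\<close> if \<open>v\<^sub>s\<close> is the highest one that occurs.
\<close>

lemma slice_sing:
  assumes w: "w \<in> Sing_upto n m (Suc p) \<kappa>" and p: "Suc p \<le> n"
    and top: "act (slice (Suc p) (Suc s)) w = 0"
  shows "act (slice (Suc p) s) w \<in> Sing_upto n m p (\<kappa> - int s)"
proof -
  have "act (\<Sum>i\<in>{1..p}. opE m i) (act (slice (Suc p) s) w) = - act (slice (Suc p) s) (act (opE m (Suc p)) w)"
  proof -
    have "act (\<Sum>i\<in>{1..p}. opE m i) (act (slice (Suc p) s) w)
        = act (slice (Suc p) s) (act (\<Sum>i\<in>{1..p}. opE m i) w)"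
      by (rule slice_total[of opE, symmetric]) simp
    also have "\<dots> = - act (slice (Suc p) s) (act (opE m (Suc p)) w)"
      unfolding lowering_slice[OF w] by (rule act_linear(5))
    finally show ?thesis .
  qed
  also have "\<dots> = 0" using top by (simp add: slice_same)
  finally show ?thesis
    using slice_supported[of w n m p \<kappa> s] w p by (simp add: Sing_upto_def del: act_sum)
qed

text \<open>
  The limit of \<open>z\<^sub>i H\<^sub>i(z)\<close> when each coordinate of \<open>z\<close> is negligible compared to the following one.
\<close>

definition limit_op :: "(nat \<Rightarrow> nat) \<Rightarrow> nat \<Rightarrow> (nat \<Rightarrow> nat) endo" where
  "limit_op m i = (\<Sum>j\<in>{1..<i}. Om m i j)"

text \<open>
  The eigenvalue of \<open>\<Omega>\<close> on the component of highest weight \<open>\<theta> + q\<close> in the product of the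
  representations with highest weights \<open>\<theta> + 2 s\<close> and \<open>q\<close>.
\<close>

definition top_value :: "int \<Rightarrow> nat \<Rightarrow> nat \<Rightarrow> complex" where
  "top_value \<theta> q s = of_int \<theta> * of_nat q / 2 - of_nat s * (of_int \<theta> + of_nat s + 1)"

text \<open>
  In \<open>G\<^bsub>p+1\<^esub> = e\<^sub>q F + f\<^sub>q E + h\<^sub>q H / 2\<close>, where \<open>q = p + 1\<close> and \<open>E, F, H\<close> act on the first \<open>p\<close> factors, the
  first term does not contribute to the highest coefficient, \<open>E w = - e\<^sub>q w\<close> turns the second one into
  an operator on the last factor, and the third one is a matter of weights.
\<close>

lemma slice_limit_op:
  assumes w: "w \<in> Sing_upto n m (Suc p) \<kappa>" and p: "Suc p \<le> n"
    and top: "act (slice (Suc p) (Suc s)) w = 0"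
  shows "act (slice (Suc p) s) (act (limit_op m (Suc p)) w)
    = cscale (top_value ((\<Sum>i\<in>{1..p}. int (m i)) - 2 * \<kappa>) (m (Suc p)) s) (act (slice (Suc p) s) w)"
proof (cases "m (Suc p) < s")
  case True
  have ws: "w \<in> supported (level n m (Suc p) \<kappa>)" using w by (simp add: Sing_upto_def)
  have "act (limit_op m (Suc p)) w \<in> supported (level n m (Suc p) \<kappa>)"
    unfolding limit_op_def act_sum
    by (intro cfun.subspace_sum[OF subspace_supported] Om_supported[OF ws]) (use p in auto)
  then show ?thesis using slice_beyond[of _ n m p \<kappa> s] p True ws by simp
next
  case False
  let ?q = "Suc p"
  define e f h where "e = (\<Sum>i\<in>{1..p}. opE m i)" and "f = (\<Sum>i\<in>{1..p}. opF m i)"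
    and "h = (\<Sum>i\<in>{1..p}. opH m i)"
  define x where "x = act (slice ?q s) w"
  define \<theta> where "\<theta> = (\<Sum>i\<in>{1..p}. int (m i)) - 2 * \<kappa>"
  have "{1..<Suc p} = {1..p}" by auto
  then have G: "limit_op m ?q = opE m ?q * f + opF m ?q * e + scal (1/2) * (opH m ?q * h)"
    by (simp add: limit_op_def Om_def e_def f_def h_def sum.distrib sum_distrib_left)
  have ew: "act e w = - act (opE m ?q) w" unfolding e_def by (rule lowering_slice[OF w])
  have 1: "act (slice ?q s) (act (opE m ?q) (act f w)) = 0"
    using slice_total[of opF p "Suc s" m w] top by (simp add: slice_same f_def del: act_sum)
  have 2: "act (slice ?q s) (act (opF m ?q) (act e w)) = cscale (- of_nat s * (of_nat (m ?q) - of_nat s + 1)) x"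
    using False unfolding ew x_def by (cases s) (simp_all add: slice_same algebra_simps)
  have "x \<in> supported (level n m p (\<kappa> - int s))"
    unfolding x_def using w p by (intro slice_supported) (auto simp: Sing_upto_def)
  then have "act h x = cscale (of_int (\<theta> + 2 * int s)) x"
    using weight_level[of x n m p "\<kappa> - int s"] p by (simp add: h_def \<theta>_def algebra_simps del: act_sum)
  then have 3: "act (slice ?q s) (act (opH m ?q) (act h w))
      = cscale ((of_nat (m ?q) - 2 * of_nat s) * of_int (\<theta> + 2 * int s)) x"
    using slice_total[of opH p s m w] False by (simp add: slice_same h_def x_def del: act_sum)
  have "act (slice ?q s) (act (limit_op m ?q) w)
      = cscale (- of_nat s * (of_nat (m ?q) - of_nat s + 1)
          + 1/2 * ((of_nat (m ?q) - 2 * of_nat s) * of_int (\<theta> + 2 * int s))) x"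
    unfolding G act_simps act_linear 1 2 3 by (simp only: cfun.scale_left_distrib cfun.scale_scale add_0_left)
  also have "- of_nat s * (of_nat (m ?q) - of_nat s + 1)
      + 1/2 * ((of_nat (m ?q) - 2 * of_nat s) * of_int (\<theta> + 2 * int s)) = top_value \<theta> (m ?q) s"
    by (simp add: top_value_def field_simps)
  finally show ?thesis by (simp add: \<theta>_def x_def)
qed

text \<open>
  As a quadratic polynomial in \<open>s\<close>, the value takes the same value only at \<open>s\<close> and \<open>- \<theta> - 1 - s\<close>, and one
  of the weights \<open>\<theta> + 2 s\<close> belonging to these two is negative.
\<close>

lemma top_value_inj:
  assumes "\<theta> + 2 * int s \<ge> 0" "\<theta> + 2 * int t \<ge> 0" "top_value \<theta> q s = top_value \<theta> q t"
  shows "s = t"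
proof -
  have "of_int (int s * (\<theta> + int s + 1)) = (of_int (int t * (\<theta> + int t + 1)) :: complex)"
    using assms(3) by (simp add: top_value_def)
  then have "int s * (\<theta> + int s + 1) = int t * (\<theta> + int t + 1)" by (simp only: of_int_eq_iff)
  then have "(int s - int t) * (\<theta> + int s + int t + 1) = 0" by (simp add: algebra_simps)
  moreover have "\<theta> + int s + int t + 1 \<noteq> 0" using assms by simp
  ultimately show ?thesis by simp
qed

definition comb_op :: "(nat \<Rightarrow> nat) \<Rightarrow> (nat \<Rightarrow> complex) \<Rightarrow> nat \<Rightarrow> (nat \<Rightarrow> nat) endo" where
  "comb_op m c p = (\<Sum>i\<in>{1..p}. scal (c i) * limit_op m i)"

lemma limit_op_sing:
  assumes "w \<in> Sing_upto n m p \<kappa>" "i \<in> {1..p}" "p \<le> n"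
  shows "act (limit_op m i) w \<in> Sing_upto n m p \<kappa>"
  unfolding limit_op_def act_sum
  by (intro cfun.subspace_sum[OF subspace_sing] Om_sing[OF assms(1)]) (use assms in auto)

lemma comb_op_sing:
  assumes "w \<in> Sing_upto n m p \<kappa>" "p \<le> n"
  shows "act (comb_op m c p) w \<in> Sing_upto n m p \<kappa>"
  unfolding comb_op_def act_sum act_simps
  by (intro cfun.subspace_sum[OF subspace_sing] cfun.subspace_scale[OF subspace_sing]
      limit_op_sing[OF assms(1)]) (use assms in auto)

lemma slice_comb_op:
  "act (slice (Suc p) s) (act (comb_op m c p) w) = act (comb_op m c p) (act (slice (Suc p) s) w)"
  unfolding comb_op_def limit_op_def act_sum act_sum_right act_simps act_linear
  by (intro sum.cong refl arg_cong[of _ _ "cscale _"] slice_Om) auto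

text \<open>
  A step of the filtration: the singular vectors in the first \<open>p + 1\<close> factors in which only
  \<open>v\<^sub>t\<close> with \<open>t < s\<close> occur in the last one.
\<close>

definition last_below :: "nat \<Rightarrow> (nat \<Rightarrow> nat) \<Rightarrow> nat \<Rightarrow> int \<Rightarrow> nat \<Rightarrow> tensor set" where
  "last_below n m p \<kappa> s = {w \<in> Sing_upto n m (Suc p) \<kappa>. \<forall>t\<ge>s. act (slice (Suc p) t) w = 0}"

lemma simple_on_zero: "simple_on K {0} []"
  by (auto simp: simple_on_def)

text \<open>
  The filtration is built up one step at a time by extensions, with the coefficient of \<open>v\<^sub>s\<close> as the
  map to the quotient. Steps with \<open>\<theta> + 2 s < 0\<close> are trivial, as there is no singular vector of that
  weight. The spectra of the other ones are shifted by multiples \<open>c\<close> of different numbers, and the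
  hypothesis \<open>sep\<close> on \<open>c\<close> keeps them apart.
\<close>

lemma simple_on_last_below:
  assumes p: "Suc p \<le> n" and L: "\<And>s. simple_on (comb_op m c p) (Sing_upto n m p (\<kappa> - int s)) (L s)"
    and lam: "\<theta> = (\<Sum>i\<in>{1..p}. int (m i)) - 2 * \<kappa>"
    and sep: "\<And>s t x y. top_value \<theta> (m (Suc p)) s \<noteq> top_value \<theta> (m (Suc p)) t \<Longrightarrow>
        s \<le> m (Suc p) \<Longrightarrow> t \<le> m (Suc p) \<Longrightarrow>
        x \<in> set (L s) \<Longrightarrow> y \<in> set (L t) \<Longrightarrow>
        x + c (Suc p) * top_value \<theta> (m (Suc p)) s \<noteq> y + c (Suc p) * top_value \<theta> (m (Suc p)) t"
    and s: "s \<le> Suc (m (Suc p))"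
  shows "\<exists>ls. simple_on (comb_op m c (Suc p)) (last_below n m p \<kappa> s) ls \<and>
    (\<forall>y\<in>set ls. \<exists>t<s. \<theta> + 2 * int t \<ge> 0 \<and> (\<exists>x\<in>set (L t). y = x + c (Suc p) * top_value \<theta> (m (Suc p)) t))"
  using s
proof (induction s)
  case 0
  have "last_below n m p \<kappa> 0 = {0}"
    using slice_eq_0D cfun.subspace_0[OF subspace_sing[of n m "Suc p" \<kappa>]] by (auto simp: last_below_def)
  then show ?case using simple_on_zero by (intro exI[of _ "[]"]) auto
next
  case (Suc s)
  let ?q = "Suc p" and ?K = "comb_op m c (Suc p)"
  let ?g = "\<lambda>t. c ?q * top_value \<theta> (m ?q) t"
  obtain ls where ls: "simple_on ?K (last_below n m p \<kappa> s) ls"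
    and ls_sub: "\<And>y. y \<in> set ls \<Longrightarrow> \<exists>t<s. \<theta> + 2 * int t \<ge> 0 \<and> (\<exists>x\<in>set (L t). y = x + ?g t)"
    using Suc by auto
  let ?V = "last_below n m p \<kappa> (Suc s)"
  have ker: "last_below n m p \<kappa> s = {w \<in> ?V. act (slice ?q s) w = 0}"
    by (auto simp: last_below_def Suc_le_eq) (metis le_eq_less_or_eq)
  have W: "act (slice ?q s) w \<in> Sing_upto n m p (\<kappa> - int s)" if "w \<in> ?V" for w
    using that p by (intro slice_sing) (auto simp: last_below_def)
  show ?case
  proof (cases "\<theta> + 2 * int s \<ge> 0")
    case False
    have "act (slice ?q s) w = 0" if "w \<in> ?V" for w
      using sing_negative_weight[OF W[OF that]] p False by (simp add: lam)
    then have "?V = last_below n m p \<kappa> s" using ker by auto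
    then show ?thesis using ls ls_sub less_SucI by metis
  next
    case True
    have Kq: "?K = comb_op m c p + scal (c ?q) * limit_op m ?q" by (simp add: comb_op_def)
    have act_K: "act (slice ?q t) (act ?K w) = act (comb_op m c p) (act (slice ?q t) w) + cscale (?g t) (act (slice ?q t) w)"
      if "w \<in> ?V" "t \<ge> s" for w t
    proof -
      have "w \<in> Sing_upto n m ?q \<kappa>" "act (slice ?q (Suc t)) w = 0" using that by (auto simp: last_below_def)
      from slice_limit_op[OF this(1) p this(2)] show ?thesis
        unfolding Kq act_simps act_linear slice_comb_op lam by simp
    qed
    have subspace: "cfun.subspace ?V"
      using subspace_sing[of n m ?q \<kappa>] unfolding last_below_def cfun.subspace_def by auto
    have inv: "act ?K w \<in> ?V" if "w \<in> ?V" for w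
    proof -
      have "act (slice ?q t) (act ?K w) = 0" if t: "t \<ge> Suc s" for t
      proof -
        have "act (slice ?q t) w = 0" using t \<open>w \<in> ?V\<close> by (simp add: last_below_def)
        then show ?thesis using act_K[OF \<open>w \<in> ?V\<close>, of t] t by simp
      qed
      then show ?thesis using that comb_op_sing[of w n m ?q \<kappa> c] p by (simp add: last_below_def)
    qed
    have "simple_on ?K ?V (ls @ map (\<lambda>\<mu>. \<mu> + ?g s) (L s))"
    proof (rule simple_on_extend[where \<pi> = "slice ?q s" and K' = "comb_op m c p"
          and W = "Sing_upto n m p (\<kappa> - int s)", OF subspace inv W _ L[of s]])
      show "act (slice ?q s) (act ?K x) = act (comb_op m c p) (act (slice ?q s) x) + cscale (?g s) (act (slice ?q s) x)"
        if "x \<in> ?V" for x using act_K[OF that] by simp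
      show "simple_on ?K {x \<in> ?V. act (slice ?q s) x = 0} ls" using ls ker by simp
      show "\<mu> + ?g s \<notin> set ls" if mu: "\<mu> \<in> set (L s)" for \<mu>
      proof
        assume "\<mu> + ?g s \<in> set ls"
        then obtain t x where t: "t < s" "\<theta> + 2 * int t \<ge> 0" "x \<in> set (L t)" "\<mu> + ?g s = x + ?g t"
          using ls_sub by blast
        have "top_value \<theta> (m ?q) s \<noteq> top_value \<theta> (m ?q) t"
          using top_value_inj[OF True t(2)] t(1) by auto
        then show False using sep[of s t \<mu> x] mu t Suc.prems by simp
      qed
    qed
    moreover have "\<exists>t<Suc s. \<theta> + 2 * int t \<ge> 0 \<and> (\<exists>x\<in>set (L t). y = x + ?g t)"
      if "y \<in> set (ls @ map (\<lambda>\<mu>. \<mu> + ?g s) (L s))" for y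
    proof (cases "y \<in> set ls")
      case True
      then obtain t where "t < s" "\<theta> + 2 * int t \<ge> 0" "\<exists>x\<in>set (L t). y = x + ?g t"
        using ls_sub[of y] by auto
      then show ?thesis by (intro exI[of _ t]) simp
    next
      case False
      then have "\<exists>x\<in>set (L s). y = x + ?g s" using that by auto
      then show ?thesis using \<open>\<theta> + 2 * int s \<ge> 0\<close> by (intro exI[of _ s]) simp
    qed
    ultimately show ?thesis by (intro exI[of _ "ls @ map (\<lambda>\<mu>. \<mu> + ?g s) (L s)"] conjI ballI)
  qed
qed

lemma last_below_top:
  assumes "Suc p \<le> n"
  shows "last_below n m p \<kappa> (Suc (m (Suc p))) = Sing_upto n m (Suc p) \<kappa>"
  using slice_beyond[OF _ assms] by (auto simp: last_below_def Sing_upto_def)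

lemma sing_negative_level:
  assumes "\<kappa> < 0" shows "Sing_upto n m p \<kappa> = {0}"
proof -
  have "level n m p \<kappa> = {}"
  proof -
    have "(\<Sum>i\<in>{1..n}. int (a i)) \<ge> 0" for a by (intro sum_nonneg) auto
    then have "(\<Sum>i\<in>{1..n}. int (a i)) \<noteq> \<kappa>" for a using assms by (metis not_le)
    then show ?thesis by (simp add: level_def)
  qed
  then have "w = 0" if "w \<in> Sing_upto n m p \<kappa>" for w
    using that by (auto simp: Sing_upto_def supported_def)
  then show ?thesis using cfun.subspace_0[OF subspace_sing] by blast
qed

lemma simple_on_base: "simple_on (comb_op m c 0) (Sing_upto n m 0 \<kappa>) [0]"
proof -
  define a0 where "a0 = (\<lambda>i. if i \<in> {1..n} then 0 else undefined :: nat)"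
  have "a = a0" if "a \<in> level n m 0 \<kappa>" for a
    using that by (auto simp: level_def tensor_index_def a0_def PiE_iff extensional_def fun_eq_iff)
  then have z: "w a = 0" if "w \<in> Sing_upto n m 0 \<kappa>" "a \<noteq> a0" for w a
    using that by (auto simp: Sing_upto_def supported_def)
  have "\<exists>c. w = cscale c v" if "v \<in> Sing_upto n m 0 \<kappa>" "w \<in> Sing_upto n m 0 \<kappa>" "v \<noteq> 0" for v w
  proof -
    have "v a0 \<noteq> 0" using z[OF that(1)] that(3) by fastforce
    then have "w a = cscale (w a0 / v a0) v a" for a
      using z[OF that(1)] z[OF that(2)] by (cases "a = a0") (auto simp: cscale_def)
    then show ?thesis by blast
  qed
  then show ?thesis by (auto simp: simple_on_def comb_op_def)
qed

text \<open>
  One \<open>c\<close> has to serve all levels up to \<open>K0\<close>, since the induction step for the level \<open>\<kappa>\<close> uses the levels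
  \<open>\<kappa> - s\<close>. Only finitely many of them are nonzero, and so only finitely many values of the new
  coefficient are excluded.
\<close>

lemma simple_limit:
  assumes "p \<le> n"
  shows "\<exists>c. \<forall>\<kappa>\<le>K0. \<exists>ls. simple_on (comb_op m c p) (Sing_upto n m p \<kappa>) ls"
  using assms
proof (induction p)
  case 0
  then show ?case using simple_on_base by blast
next
  case (Suc p)
  let ?q = "Suc p"
  obtain c L0 where L0: "\<And>\<kappa>. \<kappa> \<le> K0 \<Longrightarrow> simple_on (comb_op m c p) (Sing_upto n m p \<kappa>) (L0 \<kappa>)"
    using Suc by (metis Suc_leD)
  define L where "L \<kappa> = (if \<kappa> < 0 then [] else L0 \<kappa>)" for \<kappa>
  have L: "simple_on (comb_op m c p) (Sing_upto n m p \<kappa>) (L \<kappa>)" if "\<kappa> \<le> K0" for \<kappa>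
    using L0[OF that] sing_negative_level[of \<kappa> n m p] simple_on_zero by (auto simp: L_def)
  define \<gamma> where "\<gamma> \<kappa> s = top_value ((\<Sum>i\<in>{1..p}. int (m i)) - 2 * \<kappa>) (m ?q) s" for \<kappa> s
  \<comment> \<open>The values of the new coefficient at which two shifted spectra meet.\<close>
  define Bad where "Bad = (\<Union>\<kappa>\<in>{0..K0}. \<Union>s\<in>{..m ?q}. \<Union>t\<in>{..m ?q}. \<Union>x\<in>set (L (\<kappa> - int s)).
    \<Union>y\<in>set (L (\<kappa> - int t)). {(y - x) / (\<gamma> \<kappa> s - \<gamma> \<kappa> t)})"
  have "finite Bad" by (simp add: Bad_def)
  then obtain b where b: "b \<notin> Bad" using ex_new_if_finite[OF infinite_UNIV_char_0] by blast
  define c' where "c' = c(?q := b)"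
  have K: "comb_op m c' p = comb_op m c p"
    unfolding comb_op_def c'_def by (intro sum.cong) auto
  have "\<exists>ls. simple_on (comb_op m c' ?q) (Sing_upto n m ?q \<kappa>) ls" if kap: "\<kappa> \<le> K0" for \<kappa>
  proof (cases "\<kappa> < 0")
    case True
    then show ?thesis using sing_negative_level simple_on_zero by metis
  next
    case False
    have "\<exists>ls. simple_on (comb_op m c' ?q) (last_below n m p \<kappa> (Suc (m ?q))) ls \<and>
      (\<forall>y\<in>set ls. \<exists>t<Suc (m ?q). ((\<Sum>i\<in>{1..p}. int (m i)) - 2 * \<kappa>) + 2 * int t \<ge> 0 \<and>
        (\<exists>x\<in>set (L (\<kappa> - int t)). y = x + c' ?q * top_value ((\<Sum>i\<in>{1..p}. int (m i)) - 2 * \<kappa>) (m ?q) t))"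
    proof (rule simple_on_last_below[OF Suc.prems _ refl])
      show "simple_on (comb_op m c' p) (Sing_upto n m p (\<kappa> - int s)) (L (\<kappa> - int s))" for s
        unfolding K using kap by (intro L) simp
      fix s t x y
      assume h: "s \<le> m ?q" "t \<le> m ?q" "x \<in> set (L (\<kappa> - int s))" "y \<in> set (L (\<kappa> - int t))"
        and "top_value ((\<Sum>i\<in>{1..p}. int (m i)) - 2 * \<kappa>) (m ?q) s \<noteq> top_value ((\<Sum>i\<in>{1..p}. int (m i)) - 2 * \<kappa>) (m ?q) t"
      then have ne: "\<gamma> \<kappa> s - \<gamma> \<kappa> t \<noteq> 0" by (simp add: \<gamma>_def)
      have "(y - x) / (\<gamma> \<kappa> s - \<gamma> \<kappa> t) \<in> Bad"
        unfolding Bad_def using h kap False by (intro UN_I[of \<kappa>] UN_I[of s] UN_I[of t] UN_I[of x] UN_I[of y]) auto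
      then have "b \<noteq> (y - x) / (\<gamma> \<kappa> s - \<gamma> \<kappa> t)" using b by blast
      then have "b * (\<gamma> \<kappa> s - \<gamma> \<kappa> t) \<noteq> y - x" using ne by (simp add: eq_divide_eq)
      then have "x + b * \<gamma> \<kappa> s \<noteq> y + b * \<gamma> \<kappa> t" by (auto simp: algebra_simps)
      then show "x + c' ?q * top_value ((\<Sum>i\<in>{1..p}. int (m i)) - 2 * \<kappa>) (m ?q) s
          \<noteq> y + c' ?q * top_value ((\<Sum>i\<in>{1..p}. int (m i)) - 2 * \<kappa>) (m ?q) t"
        by (simp add: c'_def \<gamma>_def)
    qed simp
    then show ?thesis using last_below_top[OF Suc.prems] by auto
  qed
  then show ?case by blast
qed

section \<open>Generic points\<close>

lemma on_factor_op:
  assumes "w \<in> supported (level n m n \<kappa>)" "i \<in> {1..n}"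
  shows "on_factor i (sl2_e (m i)) w = act (opE m i) w"
    "on_factor i (sl2_f (m i)) w = act (opF m i) w"
    "on_factor i (sl2_h (m i)) w = act (opH m i) w"
proof -
  have z: "w (a(i := r)) = 0" if "m i < r" for a r
  proof (rule supportedD[OF assms(1)])
    show "a(i := r) \<notin> level n m n \<kappa>"
    proof
      assume "a(i := r) \<in> level n m n \<kappa>"
      then have "a(i := r) \<in> (\<Pi>\<^sub>E i\<in>{1..n}. {0..m i})" by (simp only: level_def tensor_index_def mem_Collect_eq)
      then have "(a(i := r)) i \<in> {0..m i}" by (rule PiE_mem) (rule assms(2))
      then show False using that by simp
    qed
  qed
  show "on_factor i (sl2_e (m i)) w = act (opE m i) w"
  proof
    fix a show "on_factor i (sl2_e (m i)) w a = act (opE m i) w a"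
      using z[of "a i + 1" a] by (cases "a i = m i") (auto simp: on_factor_def sl2_e_def op_apply)
  qed
  show "on_factor i (sl2_f (m i)) w = act (opF m i) w"
    by (simp add: fun_eq_iff on_factor_def sl2_f_def op_apply)
  show "on_factor i (sl2_h (m i)) w = act (opH m i) w"
  proof
    fix a show "on_factor i (sl2_h (m i)) w a = act (opH m i) w a"
      using z[of "a i" a] by (auto simp: on_factor_def sl2_h_def op_apply)
  qed
qed

text \<open>
  The weight condition in \<open>Sing\<close> says that only tensors of basis vectors with \<open>\<Sum>\<^sub>i a i = k\<close> occur.
\<close>

lemma Sing_eq: "Sing n m k = Sing_upto n m n (int k)"
proof -
  have supp: "w \<in> supported (level n m n (int k))"
    if w: "w \<in> tensor_space n m"
      and h: "tensor_h n m w = cscale (of_nat (\<Sum>i\<in>{1..n}. m i) - 2 * of_nat k) w" for w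
    unfolding supported_def
  proof safe
    fix a assume a: "w a \<noteq> 0"
    have "tensor_h n m w a = (\<Sum>i\<in>{1..n}. (of_nat (m i) - 2 * of_nat (a i)) * w a)"
      by (simp only: tensor_h_def sum_fun_apply) (simp add: on_factor_def sl2_h_def)
    also have "\<dots> = (of_nat (\<Sum>i\<in>{1..n}. m i) - 2 * of_nat (\<Sum>i\<in>{1..n}. a i)) * w a"
      by (simp add: sum_distrib_right[symmetric] sum_subtractf sum_distrib_left)
    finally have "(of_nat (\<Sum>i\<in>{1..n}. a i) :: complex) = of_nat k"
      using fun_cong[OF h, of a] a by (simp add: cscale_def)
    then have "(\<Sum>i\<in>{1..n}. a i) = k" by (simp only: of_nat_eq_iff)
    then have "(\<Sum>i\<in>{1..n}. int (a i)) = int k" by (simp flip: of_nat_sum)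
    moreover have "a \<in> tensor_index n m" using w a by (auto simp: tensor_space_def)
    ultimately show "a \<in> level n m n (int k)" by (simp add: level_def)
  qed
  have e: "tensor_e n m w = act (\<Sum>i\<in>{1..n}. opE m i) w" if "w \<in> supported (level n m n (int k))" for w
    unfolding tensor_e_def act_sum by (intro sum.cong refl on_factor_op(1)[OF that])
  have h: "tensor_h n m w = cscale (of_nat (\<Sum>i\<in>{1..n}. m i) - 2 * of_nat k) w"
    if "w \<in> supported (level n m n (int k))" for w
  proof -
    have "tensor_h n m w = act (\<Sum>i\<in>{1..n}. opH m i) w"
      unfolding tensor_h_def act_sum by (intro sum.cong refl on_factor_op(3)[OF that])
    then show ?thesis using weight_level[OF that order_refl] by simp
  qed
  have t: "w \<in> tensor_space n m" if "w \<in> supported (level n m n (int k))" for w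
    using that by (auto simp: supported_def tensor_space_def level_def)
  show ?thesis
    unfolding Sing_def Sing_upto_def using supp e h t by (auto simp del: act_sum)
qed

lemma gaudin_eq_act:
  assumes "w \<in> Sing n m k" "i \<in> {1..n}"
  shows "gaudin n m z i w = act (gaudin_op n m z i) w"
proof -
  have w: "w \<in> supported (level n m n (int k))" using assms(1) by (simp add: Sing_eq Sing_upto_def)
  have "Omega m i j w = act (Om m i j) w" if "j \<in> {1..n} - {i}" for j
  proof -
    have j: "j \<in> {1..n}" using that by simp
    note ops = op_supported[OF w j order_refl]
    show ?thesis
      unfolding Omega_def on_factor_op[OF w j] on_factor_op(1)[OF ops(2) assms(2)]
        on_factor_op(2)[OF ops(1) assms(2)] on_factor_op(3)[OF ops(3) assms(2)]
      by (simp add: Om_def)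
  qed
  then show ?thesis
    unfolding gaudin_def gaudin_op_def act_sum by (intro sum.cong refl) simp
qed

lemma simple_spectrum_cong:
  assumes "\<And>i v. i \<in> I \<Longrightarrow> v \<in> V \<Longrightarrow> H i v = H' i v" "simple_spectrum I H' V"
  shows "simple_spectrum I H V"
proof -
  obtain B ev where B: "cfun.independent B" "cfun.span B = V"
      "\<forall>b\<in>B. \<forall>i\<in>I. H' i b = cscale (ev b i) b"
      "\<forall>b\<in>B. \<forall>b'\<in>B. b \<noteq> b' \<longrightarrow> (\<exists>i\<in>I. ev b i \<noteq> ev b' i)"
    using assms(2) unfolding simple_spectrum_def by (elim exE conjE) (rule that)
  have "H i b = cscale (ev b i) b" if "b \<in> B" "i \<in> I" for b i
    using B(3) assms(1)[OF that(2), of b] cfun.span_base[OF that(1)] that by (simp add: B(2))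
  then show ?thesis
    unfolding simple_spectrum_def using B by (intro exI[of _ B] exI[of _ ev]) simp
qed

definition pairs :: "nat \<Rightarrow> (nat \<times> nat) set" where
  "pairs n = (SIGMA i:{1..n}. {1..n} - {i})"

text \<open>
  Combinations of the \<open>\<Omega>\<^sub>i\<^sub>j\<close> with arbitrary coefficients, a common form of the combinations of the
  Hamiltonians and of their limits.
\<close>

definition pair_op :: "nat \<Rightarrow> (nat \<Rightarrow> nat) \<Rightarrow> (nat \<times> nat \<Rightarrow> complex) \<Rightarrow> (nat \<Rightarrow> nat) endo" where
  "pair_op n m \<alpha> = (\<Sum>p\<in>pairs n. scal (\<alpha> p) * Om m (fst p) (snd p))"

lemma finite_pairs [simp]: "finite (pairs n)"
  by (simp add: pairs_def)

lemma pair_op_eq: "pair_op n m \<alpha> = (\<Sum>i\<in>{1..n}. \<Sum>j\<in>{1..n} - {i}. scal (\<alpha> (i, j)) * Om m i j)"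
  unfolding pair_op_def pairs_def by (subst sum.Sigma) (auto intro!: sum.cong)

lemma Om_pair_sing:
  assumes "p \<in> pairs n" "w \<in> Sing_upto n m n \<kappa>"
  shows "act (Om m (fst p) (snd p)) w \<in> Sing_upto n m n \<kappa>"
  by (rule Om_sing[OF assms(2)]) (use assms(1) in \<open>auto simp: pairs_def\<close>)

lemma pair_op_sing:
  assumes "w \<in> Sing_upto n m n \<kappa>"
  shows "act (pair_op n m \<alpha>) w \<in> Sing_upto n m n \<kappa>"
  unfolding pair_op_def act_sum act_simps
  by (intro cfun.subspace_sum[OF subspace_sing] cfun.subspace_scale[OF subspace_sing] Om_pair_sing assms)

lemma comb_op_eq_pair_op:
  "comb_op m c n = pair_op n m (\<lambda>p. if snd p < fst p then c (fst p) else 0)"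
proof -
  have "scal (c i) * limit_op m i
      = (\<Sum>j\<in>{1..n} - {i}. scal (if j < i then c i else 0) * Om m i j)" if "i \<in> {1..n}" for i
  proof -
    have "scal (c i) * limit_op m i = (\<Sum>j\<in>{1..<i}. scal (if j < i then c i else 0) * Om m i j)"
      unfolding limit_op_def sum_distrib_left by (intro sum.cong) auto
    also have "\<dots> = (\<Sum>j\<in>{1..n} - {i}. scal (if j < i then c i else 0) * Om m i j)"
      using that by (intro sum.mono_neutral_left) (auto simp: scal_0)
    finally show ?thesis .
  qed
  then show ?thesis unfolding comb_op_def pair_op_eq fst_conv snd_conv by (intro sum.cong refl)
qed

lemma gaudin_op_sing:
  assumes "w \<in> Sing_upto n m n \<kappa>" "i \<in> {1..n}"
  shows "act (gaudin_op n m z i) w \<in> Sing_upto n m n \<kappa>"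
  unfolding gaudin_op_def act_sum act_simps
  by (intro cfun.subspace_sum[OF subspace_sing] cfun.subspace_scale[OF subspace_sing] Om_sing[OF assms(1)])
     (use assms in auto)

text \<open>
  Over ordered pairs, hence up to sign the square of the Vandermonde determinant.
\<close>

definition vandermonde :: "nat \<Rightarrow> (nat \<Rightarrow> complex) \<Rightarrow> complex" where
  "vandermonde n z = (\<Prod>p\<in>pairs n. z (fst p) - z (snd p))"

text \<open>
  The coefficients of \<open>\<Sum>\<^sub>i c\<^sub>i D(z) H\<^sub>i(z)\<close>, where \<open>D(z)\<close> is \<open>vandermonde\<close>, with the denominator
  \<open>z\<^sub>i - z\<^sub>j\<close> cancelled. In this form they are polynomials in \<open>z\<close> and are defined for all \<open>z\<close>.
\<close>

definition cleared :: "nat \<Rightarrow> (nat \<Rightarrow> complex) \<Rightarrow> (nat \<Rightarrow> complex) \<Rightarrow> nat \<times> nat \<Rightarrow> complex" where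
  "cleared n c z p = c (fst p) * (\<Prod>q\<in>pairs n - {p}. z (fst q) - z (snd q))"

lemma cleared_eq:
  assumes "z \<in> config_space n" "p \<in> pairs n"
  shows "cleared n c z p = c (fst p) * vandermonde n z * (1 / (z (fst p) - z (snd p)))"
proof -
  have "z (fst p) - z (snd p) \<noteq> 0" using assms by (auto simp: config_space_def pairs_def)
  moreover have "vandermonde n z = (z (fst p) - z (snd p)) * (\<Prod>q\<in>pairs n - {p}. z (fst q) - z (snd q))"
    unfolding vandermonde_def by (rule prod.remove) (use assms in auto)
  ultimately show ?thesis by (simp add: cleared_def)
qed

lemma pair_op_cleared:
  assumes "z \<in> config_space n"
  shows "pair_op n m (cleared n c z) = (\<Sum>i\<in>{1..n}. scal (c i * vandermonde n z) * gaudin_op n m z i)"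
proof -
  have "scal (cleared n c z (i, j)) * Om m i j
      = scal (c i * vandermonde n z) * (scal (1 / (z i - z j)) * Om m i j)"
    if "i \<in> {1..n}" "j \<in> {1..n} - {i}" for i j
  proof -
    have "cleared n c z (i, j) = c i * vandermonde n z * (1 / (z i - z j))"
      using cleared_eq[OF assms, of "(i, j)" c] that by (simp add: pairs_def)
    then show ?thesis by (simp only: mult.assoc[symmetric] scal_mult)
  qed
  then show ?thesis
    unfolding pair_op_eq gaudin_op_def sum_distrib_left by (intro sum.cong refl)
qed

lemma vandermonde_nonzero: "z \<in> config_space n \<Longrightarrow> vandermonde n z \<noteq> 0"
  by (auto simp: vandermonde_def pairs_def config_space_def)

lemma fun_algebra_polynomial_fun: "fun_algebra {p. polynomial_fun n p}"
  by (auto simp: fun_algebra_def intro: polynomial_fun.intros)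

lemma polynomial_fun_cleared:
  assumes "p \<in> pairs n" shows "polynomial_fun n (\<lambda>z. cleared n c z p)"
proof -
  have diff: "polynomial_fun n (\<lambda>z. z (fst q) - z (snd q))" if "q \<in> pairs n" for q
  proof -
    have "polynomial_fun n (\<lambda>z. z (fst q) + (-1) * z (snd q))"
      using that by (intro polynomial_fun.intros) (auto simp: pairs_def)
    then show ?thesis by simp
  qed
  have "(\<lambda>z. \<Prod>q\<in>pairs n - {p}. z (fst q) - z (snd q)) \<in> {p. polynomial_fun n p}"
    by (rule fun_algebra_prod[OF fun_algebra_polynomial_fun]) (use diff in auto)
  then show ?thesis unfolding cleared_def by (intro polynomial_fun.mult polynomial_fun.const) simp
qed

lemma fun_algebra_isCont: "fun_algebra {f :: real \<Rightarrow> complex. isCont f 0}"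
  by (auto simp: fun_algebra_def)

lemma fun_algebra_discr_pair_op:
  assumes F: "fun_algebra F" and b: "basis_of d b (Sing_upto n m n \<kappa>)"
    and \<alpha>: "\<And>p. p \<in> pairs n \<Longrightarrow> (\<lambda>x. \<alpha> x p) \<in> F"
  shows "(\<lambda>x. discr (endo_mat d b (pair_op n m (\<alpha> x)))) \<in> F"
proof (rule fun_algebra_discr[OF F endo_mat_carrier])
  fix r s assume rs: "r < d" "s < d"
  have "(\<lambda>x. \<Sum>p\<in>pairs n. \<alpha> x p * endo_mat d b (Om m (fst p) (snd p)) $$ (r, s)) \<in> F"
    by (intro fun_algebra_sum[OF F] fun_algebraD(3)[OF F \<alpha> fun_algebraD(1)[OF F]])
  then show "(\<lambda>x. endo_mat d b (pair_op n m (\<alpha> x)) $$ (r, s)) \<in> F"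
    unfolding pair_op_def by (subst endo_mat_linear_comb[OF b Om_pair_sing rs])
qed

text \<open>
  The coefficients of \<open>\<Sum>\<^sub>i c\<^sub>i z\<^sub>i H\<^sub>i(z)\<close> at \<open>z\<^sub>i = \<epsilon>\<^sup>-\<^sup>i\<close>, rewritten in positive powers of \<open>\<epsilon>\<close> so that they
  are defined and continuous at \<open>\<epsilon> = 0\<close>.
\<close>

definition path_coeff :: "(nat \<Rightarrow> complex) \<Rightarrow> real \<Rightarrow> nat \<times> nat \<Rightarrow> complex" where
  "path_coeff c \<epsilon> p = (let i = fst p; j = snd p in
     if j < i then c i / (1 - of_real \<epsilon> ^ (i - j))
     else c i * of_real \<epsilon> ^ (j - i) / (of_real \<epsilon> ^ (j - i) - 1))"

lemma isCont_path_coeff: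
  assumes "p \<in> pairs n" shows "isCont (\<lambda>\<epsilon>. path_coeff c \<epsilon> p) 0"
proof (cases "snd p < fst p")
  case True
  then have "(1::complex) - of_real 0 ^ (fst p - snd p) \<noteq> 0" by (simp add: power_0_left)
  then show ?thesis using True unfolding path_coeff_def Let_def by (auto intro!: continuous_intros)
next
  case False
  then have "fst p < snd p" using assms by (auto simp: pairs_def)
  then have "of_real 0 ^ (snd p - fst p) - (1::complex) \<noteq> 0" by (simp add: power_0_left)
  then show ?thesis using False unfolding path_coeff_def Let_def by (auto intro!: continuous_intros)
qed

lemma path_coeff_0:
  assumes "p \<in> pairs n"
  shows "path_coeff c 0 p = (if snd p < fst p then c (fst p) else 0)"
  using assms by (auto simp: path_coeff_def Let_def power_0_left pairs_def)

definition path_point :: "nat \<Rightarrow> real \<Rightarrow> nat \<Rightarrow> complex" where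
  "path_point n \<epsilon> = (\<lambda>i\<in>{1..n}. (1 / of_real \<epsilon>) ^ i)"

lemma path_point_config:
  assumes "0 < \<epsilon>" "\<epsilon> < 1" shows "path_point n \<epsilon> \<in> config_space n"
proof -
  have "(1 / complex_of_real \<epsilon>) ^ i \<noteq> (1 / complex_of_real \<epsilon>) ^ j" if "i \<noteq> j" for i j
  proof
    assume "(1 / complex_of_real \<epsilon>) ^ i = (1 / complex_of_real \<epsilon>) ^ j"
    then have "complex_of_real ((1 / \<epsilon>) ^ i) = complex_of_real ((1 / \<epsilon>) ^ j)" by simp
    then have "(1 / \<epsilon>) ^ i = (1 / \<epsilon>) ^ j" by (simp only: of_real_eq_iff)
    moreover have "1 < 1 / \<epsilon>" using assms by simp
    ultimately show False using that power_inject_exp by blast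
  qed
  then show ?thesis by (auto simp: config_space_def affine_space_def path_point_def)
qed

lemma path_coeff_eq:
  assumes "0 < \<epsilon>" "\<epsilon> < 1" "p \<in> pairs n"
  defines "z \<equiv> path_point n \<epsilon>"
  shows "path_coeff c \<epsilon> p = c (fst p) * z (fst p) * (1 / (z (fst p) - z (snd p)))"
proof -
  obtain i j where p: "p = (i, j)" by fastforce
  define x where "x = complex_of_real \<epsilon>"
  have x0: "x \<noteq> 0" using assms by (simp add: x_def)
  have zi: "z i = 1 / x ^ i" "z j = 1 / x ^ j"
    using assms(3) by (auto simp: z_def path_point_def p pairs_def x_def power_one_over)
  have nz: "z i - z j \<noteq> 0"
    using path_point_config[OF assms(1,2), of n] assms(3) by (auto simp: config_space_def z_def p pairs_def)
  show ?thesis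
  proof (cases "j < i")
    case True
    have "z j = z i * x ^ (i - j)"
      using True x0 by (simp add: zi power_diff)
    then have "z i - z j = z i * (1 - x ^ (i - j))" by (simp add: algebra_simps)
    then show ?thesis using True nz by (simp add: path_coeff_def p x_def)
  next
    case False
    have ij: "z i = z j * x ^ (j - i)"
      using False x0 by (simp add: zi power_diff)
    then have "z i - z j = z j * (x ^ (j - i) - 1)" by (simp add: algebra_simps)
    then show ?thesis using False nz ij by (simp add: path_coeff_def p x_def)
  qed
qed

theorem corollary6:
  fixes n k :: nat and m :: "nat \<Rightarrow> nat"
  assumes "2 * k \<le> (\<Sum>i\<in>{1..n}. m i)"
  shows "\<exists>A. proper_algebraic_subset n A \<and>
           (\<forall>z\<in>config_space n. z \<notin> A \<longrightarrow>
              simple_spectrum {1..n} (gaudin n m z) (Sing n m k))"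
proof -
  define V where "V = Sing_upto n m n (int k)"
  have V: "cfun.subspace V" unfolding V_def by (rule subspace_sing)
  have fin: "finite (tensor_index n m)" by (auto simp: tensor_index_def intro: finite_PiE)
  obtain d b where b: "basis_of d b V"
    using ex_basis_of[OF V fin] by (auto simp: V_def Sing_upto_def supported_def level_def)
  have card_b: "card (b ` {..<d}) = d" "cfun.independent (b ` {..<d})" "cfun.span (b ` {..<d}) = V"
    using b by (auto simp: basis_of_def card_image)
  define R where "R \<alpha> = discr (endo_mat d b (pair_op n m \<alpha>))" for \<alpha>
  have R_iff: "R \<alpha> \<noteq> 0 \<longleftrightarrow> d \<le> card (spectrum_on (pair_op n m \<alpha>) V)"
      "finite (spectrum_on (pair_op n m \<alpha>) V)" for \<alpha>
    using discr_endo_mat_nonzero_iff[OF b, of "pair_op n m \<alpha>"] pair_op_sing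
    by (auto simp: R_def V_def)
  have R_algebra: "(\<lambda>x. R (\<alpha> x)) \<in> F"
    if "fun_algebra F" "\<And>p. p \<in> pairs n \<Longrightarrow> (\<lambda>x. \<alpha> x p) \<in> F"
    for F :: "('x \<Rightarrow> complex) set" and \<alpha>
    unfolding R_def by (rule fun_algebra_discr_pair_op[OF that(1) b[unfolded V_def] that(2)])
  have R_cong: "R \<alpha> = R \<beta>" if "\<And>p. p \<in> pairs n \<Longrightarrow> \<alpha> p = \<beta> p" for \<alpha> \<beta>
    unfolding R_def pair_op_def using that by (simp cong: sum.cong)

  obtain c ls where simple: "simple_on (comb_op m c n) V ls"
    using simple_limit[of n n "int k" m] unfolding V_def by blast
  have "card (b ` {..<d}) \<le> card (spectrum_on (comb_op m c n) V)"
  proof (rule card_spectrum_of_simple_on[OF V _ simple _ card_b(2)])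
    show "act (comb_op m c n) x \<in> V" if "x \<in> V" for x
      using comb_op_sing that by (simp add: V_def)
    show "b ` {..<d} \<subseteq> V" using cfun.span_superset[of "b ` {..<d}"] unfolding card_b(3) .
  qed
  then have "R (\<lambda>p. if snd p < fst p then c (fst p) else 0) \<noteq> 0"
    using card_b by (simp add: R_iff comb_op_eq_pair_op)
  moreover have "R (path_coeff c 0) = R (\<lambda>p. if snd p < fst p then c (fst p) else 0)"
    by (rule R_cong) (rule path_coeff_0)
  ultimately have R0: "R (path_coeff c 0) \<noteq> 0" by simp
  have "isCont (\<lambda>\<epsilon>. R (path_coeff c \<epsilon>)) 0"
    using R_algebra[OF fun_algebra_isCont, of "path_coeff c"] isCont_path_coeff by blast
  then have "\<forall>\<^sub>F \<epsilon> in at 0. R (path_coeff c \<epsilon>) \<noteq> 0"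
    using R0 unfolding isCont_def by (rule tendsto_imp_eventually_ne)
  then obtain \<delta> where \<delta>: "\<delta> > 0" "\<And>\<epsilon>. \<epsilon> \<noteq> 0 \<Longrightarrow> dist \<epsilon> 0 < \<delta> \<Longrightarrow> R (path_coeff c \<epsilon>) \<noteq> 0"
    unfolding eventually_at by auto
  define \<epsilon> where "\<epsilon> = min (\<delta> / 2) (1 / 2)"
  have \<epsilon>: "0 < \<epsilon>" "\<epsilon> < 1" "R (path_coeff c \<epsilon>) \<noteq> 0"
    using \<delta> by (auto simp: \<epsilon>_def)

  define z0 where "z0 = path_point n \<epsilon>"
  have z0: "z0 \<in> config_space n" unfolding z0_def by (rule path_point_config[OF \<epsilon>(1,2)])
  \<comment> \<open>At \<open>z0\<close> these constants turn \<open>D(z) H\<^sub>i(z)\<close> into \<open>c\<^sub>i z\<^sub>i H\<^sub>i(z)\<close>.\<close>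
  define c' where "c' i = c i * z0 i / vandermonde n z0" for i
  have "cleared n c' z0 p = path_coeff c \<epsilon> p" if "p \<in> pairs n" for p
    using cleared_eq[OF z0 that] path_coeff_eq[OF \<epsilon>(1,2) that] vandermonde_nonzero[OF z0]
    by (simp add: c'_def z0_def)
  then have "R (cleared n c' z0) = R (path_coeff c \<epsilon>)" by (rule R_cong)
  then have Rz0: "R (cleared n c' z0) \<noteq> 0" using \<epsilon>(3) by simp

  define A where "A = {z \<in> affine_space n. R (cleared n c' z) = 0}"
  have "polynomial_fun n (\<lambda>z. R (cleared n c' z))"
    using R_algebra[OF fun_algebra_polynomial_fun, of "cleared n c'"] polynomial_fun_cleared by blast
  then have "algebraic_subset n A"
    unfolding algebraic_subset_def A_def by (intro exI[of _ "{\<lambda>z. R (cleared n c' z)}"]) auto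
  moreover have "z0 \<in> affine_space n" "z0 \<notin> A"
    using z0 Rz0 by (auto simp: config_space_def A_def)
  ultimately have "proper_algebraic_subset n A" unfolding proper_algebraic_subset_def by blast
  moreover have "simple_spectrum {1..n} (gaudin n m z) (Sing n m k)"
    if z: "z \<in> config_space n" "z \<notin> A" for z
  proof (rule simple_spectrum_cong)
    let ?K = "pair_op n m (cleared n c' z)"
    have "R (cleared n c' z) \<noteq> 0" using z by (auto simp: A_def config_space_def)
    then have card: "card (b ` {..<d}) \<le> card (spectrum_on ?K V)" using R_iff card_b by simp
    have "simple_spectrum {1..n} (\<lambda>i. act (gaudin_op n m z i)) V"
    proof (rule simple_spectrum_of_card[OF V _ card_b(3) card R_iff(2)])
      show "finite (b ` {..<d})" by simp
      show "act (gaudin_op n m z i) x \<in> V" if "i \<in> {1..n}" "x \<in> V" for i x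
        using gaudin_op_sing that by (simp add: V_def)
      show "?K * gaudin_op n m z i = gaudin_op n m z i * ?K" if i: "i \<in> {1..n}" for i
        unfolding pair_op_cleared[OF z(1)] sum_distrib_left sum_distrib_right
      proof (rule sum.cong[OF refl])
        fix j assume j: "j \<in> {1..n}"
        let ?s = "scal (c' j * vandermonde n z) :: (nat \<Rightarrow> nat) endo"
        have "?s * gaudin_op n m z j * gaudin_op n m z i = ?s * (gaudin_op n m z i * gaudin_op n m z j)"
          by (simp only: mult.assoc gaudin_op_commute[OF z(1) j i])
        also have "\<dots> = gaudin_op n m z i * (?s * gaudin_op n m z j)"
          by (simp only: mult.assoc[symmetric] scal_central[of _ "gaudin_op n m z i"])
        finally show "?s * gaudin_op n m z j * gaudin_op n m z i
            = gaudin_op n m z i * (?s * gaudin_op n m z j)" .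
      qed
      show "\<exists>e. \<forall>x\<in>V. act ?K x = (\<Sum>i\<in>{1..n}. cscale (e i) (act (gaudin_op n m z i) x))"
        unfolding pair_op_cleared[OF z(1)]
        by (intro exI[of _ "\<lambda>i. c' i * vandermonde n z"]) simp
    qed
    then show "simple_spectrum {1..n} (\<lambda>i. act (gaudin_op n m z i)) (Sing n m k)"
      by (simp add: V_def Sing_eq)
    show "gaudin n m z i v = act (gaudin_op n m z i) v" if "i \<in> {1..n}" "v \<in> Sing n m k" for i v
      using gaudin_eq_act that by blast
  qed
  ultimately show ?thesis by blast
qed

end
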